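(* Let $m:\mathbb{R}\times\mathbb{R}\to\mathbb{S}^2$ be a solution of the Cauchy problem $$m_t(x,t)=m(x,t)\times|\nabla|m(x,t)\quad\text{for all }(x,t)\in\mathbb{R}^2,$$ $$m(x,0)=m_0+i\sum_{j=1}^N\frac{s_j^0}{x-x_j^0}-i\sum_{j=1}^N\frac{\bar s_j^0}{x-\bar x_j^0}\quad\text{for all }x\in\mathbb{R}.$$ It is known that $m$ is then of the form $$m(x,t)=m_0+i\sum_{j=1}^N\frac{s_j(t)}{x-x_j(t)}-i\sum_{j=1}^N\frac{\bar s_j(t)}{x-\bar x_j(t)}.$$ Assume that there is no pair of indices $i\neq j$ such that $x_i(t)-x_j(t)\to0$ as $t\to t_0$, for any finite time $t_0$. Then there exist no index $i\in\{1,\dots,N\}$ and finite time $t_0$ such that $\mathrm{Im}(x_i(t))\to0$ as $t\to t_0$, even up to a subsequence (i.e. not even along some sequence of times $t_n\to t_0$).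
   Context: Notation: for $u,v\in\mathbb{C}^3$, $u\cdot v=u_1v_1+u_2v_2+u_3v_3$ and $u\times v$ are the complex-bilinear dot and cross products, and $\bar u$ is the complex conjugate. $\mathbb{S}^2\subset\mathbb{R}^3$ is the unit sphere. The operator $|\nabla|$ acts in $x$ by $\widehat{|\nabla|u}(\xi)=|\xi|\hat u(\xi)$; the equation $m_t=m\times|\nabla|m$ is the half-wave maps equation. In the rational form of $m$, $m_0$ is a constant vector, the spins $s_j$ belong to $\mathbb{C}^3$ and the poles $x_j$ to the upper half plane $\mathbb{C}^+$, with $s_j(0)=s_j^0$ and $x_j(0)=x_j^0$. The spins and poles evolve according to $$\dot s_j=-2\sum_{k\neq j}\frac{s_j\times s_k}{(x_j-x_k)^2},\qquad \ddot x_j=4\sum_{k\ne j}\frac{s_j\cdot s_k}{(x_j-x_k)^3},$$ with, at $t=0$, $$\dot x_j=\frac{s_j\times\bar s_j}{s_j\cdot\bar s_j}\cdot\Big(i m_0-\sum_{k\ne j}\frac{s_k}{x_j-x_k}+\sum_{k=1}^N\frac{\bar s_k}{x_j-\bar x_k}\Big).$$ Since $m$ takes values in $\mathbb{S}^2$, the constraints $s_j\cdot s_j=0$ and $s_j\cdot\big(i m_0-\sum_{k\ne j}\frac{s_k}{x_j-x_k}+\sum_{k}\frac{\bar s_k}{x_j-\bar x_k}\big)=0$ are imposed. *)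

theory Defs
  imports "HOL-Analysis.Analysis"
begin

section \<open>Complex-bilinear vector algebra\<close>

definition cvec :: "real ^ 3 \<Rightarrow> complex ^ 3"
  where "cvec v = (\<chi> k. complex_of_real (v $ k))"

definition cnjv :: "complex ^ 3 \<Rightarrow> complex ^ 3"
  where "cnjv u = (\<chi> k. cnj (u $ k))"

text \<open>The library inner product on \<^typ>\<open>complex ^ 3\<close> is the real one, and
  \<^const>\<open>cross3\<close> is restricted to real vectors; hence the two bilinear products below.\<close>

definition cdot :: "complex ^ 3 \<Rightarrow> complex ^ 3 \<Rightarrow> complex"
  where "cdot u v = u$1 * v$1 + u$2 * v$2 + u$3 * v$3"

definition ccross :: "complex ^ 3 \<Rightarrow> complex ^ 3 \<Rightarrow> complex ^ 3"
  where "ccross u v =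
    vector [u$2 * v$3 - u$3 * v$2, u$3 * v$1 - u$1 * v$3, u$1 * v$2 - u$2 * v$1]"


section \<open>The operator \<open>|\<nabla>|\<close> and the half-wave maps equation\<close>

definition square_integrable :: "(real \<Rightarrow> complex) \<Rightarrow> bool"
  where "square_integrable u \<longleftrightarrow>
    u \<in> borel_measurable lborel \<and> integrable lborel (\<lambda>y. (cmod (u y))\<^sup>2)"

text \<open>\<open>g\<close> is the Plancherel transform of \<open>u\<close>: the \<open>L\<^sup>2\<close> limit, as \<open>R \<rightarrow> \<infinity>\<close>, of
  \<open>\<integral> exp (- \<i> \<xi> y) u y dy\<close> over \<open>{-R..R}\<close>. No \<open>2 \<pi>\<close> occurs in the exponent, so that
  \<open>\<xi>\<close> is the frequency for which \<open>d/dy\<close> has the symbol \<open>\<i> \<xi>\<close>.\<close>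

definition has_fourier :: "(real \<Rightarrow> complex) \<Rightarrow> (real \<Rightarrow> complex) \<Rightarrow> bool"
  where "has_fourier u g \<longleftrightarrow> square_integrable u \<and> square_integrable g \<and>
    ((\<lambda>R. \<integral>\<^sup>+ \<xi>. ennreal ((cmod (g \<xi> - (LINT y:{-R..R}|lborel. cis (- (\<xi> * y)) * u y)))\<^sup>2) \<partial>lborel)
       \<longlongrightarrow> 0) at_top"

text \<open>\<open>v = |\<nabla>| u\<close>. A map with values in the sphere is not in \<open>L\<^sup>2\<close>; as \<open>|\<nabla>|\<close>
  annihilates constants, the transform is taken of \<open>u - c\<close> for the (only possible) constant
  vector \<open>c\<close> making the difference square integrable. Continuity selects the representative of
  the \<open>L\<^sup>2\<close> class, so that pointwise values of \<open>v\<close> are meaningful.\<close>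

definition has_abs_nabla :: "(real \<Rightarrow> real ^ 3) \<Rightarrow> (real \<Rightarrow> real ^ 3) \<Rightarrow> bool"
  where "has_abs_nabla u v \<longleftrightarrow> continuous_on UNIV v \<and>
    (\<exists>c. \<forall>k. \<exists>g. has_fourier (\<lambda>y. complex_of_real (u y $ k - c $ k)) g \<and>
                has_fourier (\<lambda>y. complex_of_real (v y $ k)) (\<lambda>\<xi>. complex_of_real \<bar>\<xi>\<bar> * g \<xi>))"

text \<open>A sphere-valued solution \<open>m y t\<close> of \<open>m\<^sub>t = m \<times> |\<nabla>| m\<close> for all real \<open>y\<close> and all times
  \<open>t \<in> T\<close>.\<close>

definition half_wave_map :: "real set \<Rightarrow> (real \<Rightarrow> real \<Rightarrow> real ^ 3) \<Rightarrow> bool"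
  where "half_wave_map T m \<longleftrightarrow>
    (\<forall>t\<in>T. \<forall>y. m y t \<in> sphere 0 1) \<and>
    (\<forall>t\<in>T. \<exists>v. has_abs_nabla (\<lambda>y. m y t) v \<and>
       (\<forall>y. ((\<lambda>\<tau>. m y \<tau>) has_vector_derivative cross3 (m y t) (v y)) (at t)))"


section \<open>Rational form, spins and poles\<close>

definition rational_map ::
    "nat \<Rightarrow> real ^ 3 \<Rightarrow> (nat \<Rightarrow> complex ^ 3) \<Rightarrow> (nat \<Rightarrow> complex) \<Rightarrow> real \<Rightarrow> complex ^ 3"
  where "rational_map N m\<^sub>0 s x y = cvec m\<^sub>0
    + \<i> *s (\<Sum>j=1..N. (1 / (of_real y - x j)) *s s j)
    - \<i> *s (\<Sum>j=1..N. (1 / (of_real y - cnj (x j))) *s cnjv (s j))"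

text \<open>\<open>\<i>\<close> times the regular part at \<open>x j\<close> of the map above.\<close>

definition pole_field ::
    "nat \<Rightarrow> real ^ 3 \<Rightarrow> (nat \<Rightarrow> complex ^ 3) \<Rightarrow> (nat \<Rightarrow> complex) \<Rightarrow> nat \<Rightarrow> complex ^ 3"
  where "pole_field N m\<^sub>0 s x j = \<i> *s cvec m\<^sub>0
    - (\<Sum>k\<in>{1..N} - {j}. (1 / (x j - x k)) *s s k)
    + (\<Sum>k=1..N. (1 / (x j - cnj (x k))) *s cnjv (s k))"

definition spin_constraints ::
    "nat \<Rightarrow> real ^ 3 \<Rightarrow> (nat \<Rightarrow> complex ^ 3) \<Rightarrow> (nat \<Rightarrow> complex) \<Rightarrow> bool"
  where "spin_constraints N m\<^sub>0 s x \<longleftrightarrow>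
    (\<forall>j\<in>{1..N}. cdot (s j) (s j) = 0 \<and> cdot (s j) (pole_field N m\<^sub>0 s x j) = 0)"

text \<open>The system for spins \<open>s j t\<close> and poles \<open>x j t\<close> on the time set \<open>T\<close>, \<open>w j\<close> being the
  velocity of \<open>x j\<close>. The parameter \<open>\<sigma> = \<plusminus>1\<close> is the orientation of time: the system is
  usually displayed with \<open>\<sigma> = 1\<close>, which belongs to \<open>m\<^sub>t = m \<times> \<H> m\<^sub>x\<close> with the Hilbert transform
  \<open>\<H> f(y) = (1/\<pi>) PV \<integral> f(z) / (z - y) dz\<close>, that is, to \<open>m\<^sub>t = - m \<times> |\<nabla>| m\<close>. For
  \<open>m\<^sub>t = m \<times> |\<nabla>| m\<close> with \<open>|\<nabla>|\<close> of symbol \<open>|\<xi>|\<close>, comparing double poles gives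
  \<open>w j * s j = s j \<times> pole_field j\<close>, hence the first-order relations hold with \<open>\<sigma> = -1\<close>
  (the second-order equation is invariant under time reversal).\<close>

definition spin_pole_dynamics ::
    "real \<Rightarrow> nat \<Rightarrow> real set \<Rightarrow> real ^ 3 \<Rightarrow> (nat \<Rightarrow> real \<Rightarrow> complex ^ 3) \<Rightarrow> (nat \<Rightarrow> real \<Rightarrow> complex) \<Rightarrow> bool"
  where "spin_pole_dynamics \<sigma> N T m\<^sub>0 s x \<longleftrightarrow> (\<exists>w :: nat \<Rightarrow> real \<Rightarrow> complex. \<forall>j\<in>{1..N}.
    (\<forall>t\<in>T. (s j has_vector_derivative
        of_real (- 2 * \<sigma>) *s (\<Sum>k\<in>{1..N} - {j}. (1 / (x j t - x k t)\<^sup>2) *s ccross (s j t) (s k t))) (at t)) \<and>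
    (\<forall>t\<in>T. (x j has_vector_derivative w j t) (at t)) \<and>
    (\<forall>t\<in>T. (w j has_vector_derivative
        4 * (\<Sum>k\<in>{1..N} - {j}. cdot (s j t) (s k t) / (x j t - x k t) ^ 3)) (at t)) \<and>
    w j 0 = of_real \<sigma> *
      cdot ((1 / cdot (s j 0) (cnjv (s j 0))) *s ccross (s j 0) (cnjv (s j 0)))
           (pole_field N m\<^sub>0 (\<lambda>k. s k 0) (\<lambda>k. x k 0) j))"

end

theory Submission
  imports Defs "Jordan_Normal_Form.Spectral_Radius"
begin

text \<open>The pair of matrices in \<open>lax_L\<close>, \<open>lax_A\<close> is a Lax pair for the dynamics, and it follows that the
  poles \<open>x j t\<close> are the eigenvalues of a matrix which is affine in \<open>t\<close>. Hence they stay bounded and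
  converge at every finite time \<open>t\<^sub>0\<close>, and in the absence of collisions they are uniformly separated
  near \<open>t\<^sub>0\<close>. For separated poles the bound \<open>|m| = 1\<close> forces \<open>|s j| \<le> C Im (x j)\<close>. So the spins are
  bounded near \<open>t\<^sub>0\<close>, their equation becomes linear with bounded coefficients, and by Gronwall no spin
  tends to \<open>0\<close>; then no \<open>Im (x j)\<close> does either.\<close>

section \<open>Isospectral flows\<close>

text \<open>The hypothesis on collisions speaks of limits only. A priori two poles could come close
  along a sequence of times while \<open>x i t - x j t\<close> has no limit, and then separation
  would fail without any collision in the sense of the hypothesis. The Lax pair closes this gap: the
  eigenvalues of a matrix affine in time have finitely many possible cluster values at
  \<open>t\<^sub>0\<close>, and a continuous curve with finitely many cluster values converges.
  Separation is then used twice, in the denominators of the spin equation and to isolate a single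
  residue of the rational map. A second obstacle is that the Lax pair is written in spinor
  components and divides by one of them. One frame must therefore serve all spins at all times, and
  such a frame exists only because no spin vanishes on the time interval. The estimate of a spin by
  the height of its pole acts in two ways: it bounds the other spins, which are the coefficients of
  the equation, and along the given sequence of times it makes the spin itself tend to 0.\<close>

lemma det_mat_eq:
  fixes M :: "nat \<Rightarrow> nat \<Rightarrow> complex"
  shows "det (mat n n (\<lambda>(i, j). M i j)) =
    (\<Sum>p\<in>{p. p permutes {0..<n}}. signof p * (\<Prod>i\<in>{0..<n}. M i (p i)))"
proof -
  have "mat n n (\<lambda>(i, j). M i j) $$ (i, p i) = M i (p i)" if "p permutes {0..<n}" "i \<in> {0..<n}" for p i
    using that permutes_in_image[OF that(1), of i] by simp
  then show ?thesis by (subst det_def'[of _ n]) auto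
qed

text \<open>The derivative of the Leibniz sum involves only the entries and their first derivatives
  at the point. A curve of matrices can therefore be exchanged for any other with the same
  first-order data, without computing \<open>D\<close>.\<close>

lemma has_vector_derivative_det:
  fixes B C :: "real \<Rightarrow> nat \<Rightarrow> nat \<Rightarrow> complex"
  assumes B: "\<And>i j. i < n \<Longrightarrow> j < n \<Longrightarrow> ((\<lambda>t. B t i j) has_vector_derivative B' i j) (at a)"
    and C: "\<And>i j. i < n \<Longrightarrow> j < n \<Longrightarrow> ((\<lambda>t. C t i j) has_vector_derivative B' i j) (at b)"
    and eq: "\<And>i j. i < n \<Longrightarrow> j < n \<Longrightarrow> B a i j = C b i j"
  obtains D where "((\<lambda>t. det (mat n n (\<lambda>(i, j). B t i j))) has_vector_derivative D) (at a)"
    "((\<lambda>t. det (mat n n (\<lambda>(i, j). C t i j))) has_vector_derivative D) (at b)"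
proof -
  let ?P = "{p. p permutes {0..<n}}"
  define D where "D x M = (\<Sum>p\<in>?P. signof p * (\<Sum>i\<in>{0..<n}. (x *\<^sub>R B' i (p i)) * (\<Prod>j\<in>{0..<n} - {i}. M j (p j))))"
    for x :: real and M :: "nat \<Rightarrow> nat \<Rightarrow> complex"
  have deriv: "((\<lambda>t. det (mat n n (\<lambda>(i, j). E t i j))) has_derivative (\<lambda>x. D x (E c))) (at c)"
    if E: "\<And>i j. i < n \<Longrightarrow> j < n \<Longrightarrow> ((\<lambda>t. E t i j) has_vector_derivative B' i j) (at c)"
    for E :: "real \<Rightarrow> nat \<Rightarrow> nat \<Rightarrow> complex" and c
    unfolding det_mat_eq D_def
    using E unfolding has_vector_derivative_def
    by (intro has_derivative_sum has_derivative_mult_right has_derivative_prod)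
       (auto simp: permutes_in_image)
  have "D x (B a) = D x (C b)" for x
    unfolding D_def using eq
    by (intro sum.cong refl arg_cong2[where f = "(*)"] prod.cong) (auto simp: permutes_in_image)
  moreover have "D x M = x *\<^sub>R D 1 M" for x M
    by (simp add: D_def scaleR_sum_right[symmetric])
  ultimately obtain E where "\<And>x. D x (B a) = x *\<^sub>R E" "\<And>x. D x (C b) = x *\<^sub>R E"
    by metis
  then show ?thesis
    using that[of E] deriv[OF B] deriv[OF C]
    unfolding has_vector_derivative_def by simp
qed

text \<open>To first order, \<open>t \<mapsto> B t\<close> agrees with \<open>h \<mapsto> (1 + h A) B (1 - h A)\<close>, whose determinant is
  even in \<open>h\<close>.\<close>

lemma det_isospectral_flow_deriv:
  fixes B :: "real \<Rightarrow> nat \<Rightarrow> nat \<Rightarrow> complex" and A :: "nat \<Rightarrow> nat \<Rightarrow> complex"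
  assumes B: "\<And>i j. i < n \<Longrightarrow> j < n \<Longrightarrow> ((\<lambda>t. B t i j) has_vector_derivative
    (\<Sum>k<n. A i k * B a k j - B a i k * A k j)) (at a)"
  shows "((\<lambda>t. det (mat n n (\<lambda>(i, j). B t i j))) has_vector_derivative 0) (at a)"
proof -
  define P where "P h = mat n n (\<lambda>(i, j). (if i = j then 1 else 0) + of_real h * A i j)" for h :: real
  define M where "M = mat n n (\<lambda>(i, j). B a i j)"
  define C where "C h i j = (\<Sum>l<n. (\<Sum>k<n. ((if i = k then 1 else 0) + of_real h * A i k) * B a k l)
     * ((if l = j then 1 else 0) - of_real h * A l j))" for h :: real and i j
  have mat_C: "mat n n (\<lambda>(i, j). C h i j) = P h * M * P (- h)" for h
    unfolding P_def M_def
    by (rule eq_matI) (auto simp: C_def scalar_prod_def atLeast0LessThan)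
  have C_expand: "C h i j = B a i j + of_real h * (\<Sum>k<n. A i k * B a k j - B a i k * A k j)
      - (of_real h)\<^sup>2 * (\<Sum>l<n. (\<Sum>k<n. A i k * B a k l) * A l j)"
    if "i < n" "j < n" for h i j
  proof -
    have 1: "(\<Sum>k<n. ((if i = k then 1 else 0) + of_real h * A i k) * B a k l)
       = B a i l + of_real h * (\<Sum>k<n. A i k * B a k l)" for l
      using that by (simp add: distrib_right sum.distrib sum_distrib_left mult.assoc if_distrib
          [where f="\<lambda>x. x * _"] cong: if_cong)
    have "C h i j = (\<Sum>l<n. (B a i l + of_real h * (\<Sum>k<n. A i k * B a k l)) * (if l = j then 1 else 0))
       - of_real h * (\<Sum>l<n. B a i l * A l j)
       - (of_real h)\<^sup>2 * (\<Sum>l<n. (\<Sum>k<n. A i k * B a k l) * A l j)"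
      unfolding C_def 1 by (simp only: sum_distrib_left[of "of_real h" "\<lambda>l. B a i l * A l j"]
          sum_distrib_left[of "(of_real h)\<^sup>2"] sum_subtractf[symmetric])
        (intro sum.cong refl, simp add: algebra_simps power2_eq_square)
    also have "(\<Sum>l<n. (B a i l + of_real h * (\<Sum>k<n. A i k * B a k l)) * (if l = j then 1 else 0))
       = B a i j + of_real h * (\<Sum>k<n. A i k * B a k j)"
      using that by (simp add: if_distrib[where f="\<lambda>x. _ * x"] cong: if_cong)
    finally show ?thesis by (simp add: sum_subtractf algebra_simps)
  qed
  have deriv_C: "((\<lambda>h. C h i j) has_vector_derivative
    (\<Sum>k<n. A i k * B a k j - B a i k * A k j)) (at 0)" if "i < n" "j < n" for i j
    unfolding C_expand[OF that] power2_eq_square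
    by (auto intro!: derivative_eq_intros)
  \<comment> \<open>By multiplicativity the determinant is
    \<open>det (P h) * det M * det (P (- h))\<close>, which is symmetric in \<open>h\<close> and
    \<open>- h\<close>.\<close>
  have even: "det (mat n n (\<lambda>(i, j). C (- h) i j)) = det (mat n n (\<lambda>(i, j). C h i j))" for h
  proof -
    have "P h \<in> carrier_mat n n" "M \<in> carrier_mat n n" for h
      by (auto simp: P_def M_def)
    then show ?thesis unfolding mat_C
      by (simp add: det_mult[where n = n] mult_carrier_mat[where n = n])
  qed
  obtain D where D: "((\<lambda>t. det (mat n n (\<lambda>(i, j). B t i j))) has_vector_derivative D) (at a)"
    and D': "((\<lambda>h. det (mat n n (\<lambda>(i, j). C h i j))) has_vector_derivative D) (at 0)"
    by (rule has_vector_derivative_det[where B = B and C = C and a = a and b = 0, OF B deriv_C]) (auto simp: C_expand)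
  have "(uminus has_vector_derivative - 1) (at (0::real))"
    by (auto intro!: derivative_eq_intros)
  from vector_diff_chain_at[OF this, of "\<lambda>h. det (mat n n (\<lambda>(i, j). C h i j))" D] D'
  have "((\<lambda>h. det (mat n n (\<lambda>(i, j). C (- h) i j))) has_vector_derivative - D) (at 0)"
    unfolding o_def minus_zero scaleR_minus_left scaleR_one by blast
  with D' have "D = - D"
    unfolding even by (rule vector_derivative_unique_at)
  with D show ?thesis by simp
qed

lemma det_isospectral_flow_constant:
  fixes B :: "real \<Rightarrow> nat \<Rightarrow> nat \<Rightarrow> complex" and A :: "real \<Rightarrow> nat \<Rightarrow> nat \<Rightarrow> complex"
  assumes "is_interval T" and "a \<in> T" "b \<in> T"
    and B: "\<And>t i j. t \<in> T \<Longrightarrow> i < n \<Longrightarrow> j < n \<Longrightarrow> ((\<lambda>t. B t i j) has_vector_derivative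
    (\<Sum>k<n. A t i k * B t k j - B t i k * A t k j)) (at t)"
  shows "det (mat n n (\<lambda>(i, j). B a i j)) = det (mat n n (\<lambda>(i, j). B b i j))"
proof -
  let ?f = "\<lambda>t. det (mat n n (\<lambda>(i, j). B t i j))"
  have "(?f has_derivative (\<lambda>h. 0)) (at t within T)" if "t \<in> T" for t
  proof -
    have "(?f has_vector_derivative 0) (at t)"
      by (rule det_isospectral_flow_deriv[where A = "A t"]) (rule B[OF that])
    then show ?thesis
      unfolding has_vector_derivative_def scaleR_zero_right by (rule has_derivative_at_withinI)
  qed
  then obtain c where "\<And>t. t \<in> T \<Longrightarrow> ?f t = c"
    using has_derivative_zero_constant[of T ?f] assms(1) by (auto simp: is_interval_convex_1)
  with assms(2,3) show ?thesis by metis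
qed

lemma mat_minus_smult_one:
  "mat n n (\<lambda>(i, j). M i j - (if i = j then z else 0)) = char_matrix (mat n n (\<lambda>(i, j). M i j)) z"
  unfolding char_matrix_def by (rule eq_matI) auto

lemma finite_char_roots:
  fixes M :: "nat \<Rightarrow> nat \<Rightarrow> complex"
  shows "finite {z. det (mat n n (\<lambda>(i, j). M i j - (if i = j then z else 0))) = 0}"
proof -
  let ?M = "mat n n (\<lambda>(i, j). M i j)"
  have "?M \<in> carrier_mat n n" by simp
  from card_finite_spectrum(1)[OF this] show ?thesis
    unfolding mat_minus_smult_one spectrum_def eigenvalue_det[OF \<open>?M \<in> carrier_mat n n\<close>] .
qed

text \<open>As for Gershgorin discs, the eigenvalue equation is read in the row where an eigenvector
  has its entry of largest modulus. This is what keeps the poles bounded for bounded times.\<close>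

lemma char_root_bound:
  fixes M :: "nat \<Rightarrow> nat \<Rightarrow> complex"
  assumes det0: "det (mat n n (\<lambda>(i, j). M i j - (if i = j then z else 0))) = 0"
    and K: "\<And>i j. i < n \<Longrightarrow> j < n \<Longrightarrow> cmod (M i j) \<le> K"
  shows "cmod z \<le> n * K"
proof -
  let ?M = "mat n n (\<lambda>(i, j). M i j)"
  have "eigenvalue ?M z"
    using det0 by (subst eigenvalue_det[of _ n]) (auto simp: mat_minus_smult_one)
  then obtain v where v: "v \<in> carrier_vec n" "v \<noteq> 0\<^sub>v n" "?M *\<^sub>v v = z \<cdot>\<^sub>v v"
    by (auto simp: eigenvalue_def eigenvector_def)
  have "\<exists>i<n. vec_index v i \<noteq> 0"
    using v(1,2) by (metis carrier_vecD eq_vecI index_zero_vec)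
  then have "n > 0" by auto
  define m where "m = Max ((\<lambda>i. cmod (vec_index v i)) ` {..<n})"
  have le_m: "cmod (vec_index v i) \<le> m" if "i < n" for i
    unfolding m_def using that by (intro Max_ge) auto
  have "m \<in> (\<lambda>i. cmod (vec_index v i)) ` {..<n}"
    unfolding m_def using \<open>n > 0\<close> by (intro Max_in) auto
  then obtain i where i: "i < n" "m = cmod (vec_index v i)" by auto
  have "m > 0"
    using \<open>\<exists>i<n. vec_index v i \<noteq> 0\<close> le_m by (metis order_less_le_trans zero_less_norm_iff)
  have "K \<ge> 0" using order_trans[OF norm_ge_zero K[OF i(1) i(1)]] .
  have "z * vec_index v i = vec_index (?M *\<^sub>v v) i" using v i by simp
  also have "\<dots> = (\<Sum>j<n. M i j * vec_index v j)"
    using v(1) i(1) by (simp add: scalar_prod_def atLeast0LessThan)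
  finally have "cmod z * m = cmod (\<Sum>j<n. M i j * vec_index v j)"
    using i(2) by (metis norm_mult)
  also have "\<dots> \<le> (\<Sum>j<n. cmod (M i j) * cmod (vec_index v j))"
    unfolding norm_mult[symmetric] by (rule norm_sum)
  also have "\<dots> \<le> (\<Sum>j<n. K * m)"
    by (intro sum_mono mult_mono K le_m i) (use \<open>K \<ge> 0\<close> in auto)
  also have "\<dots> = (n * K) * m" by simp
  finally show ?thesis using \<open>m > 0\<close> by simp
qed

lemma tendsto_det:
  fixes B :: "'a \<Rightarrow> nat \<Rightarrow> nat \<Rightarrow> complex"
  assumes "\<And>i j. i < n \<Longrightarrow> j < n \<Longrightarrow> ((\<lambda>t. B t i j) \<longlongrightarrow> C i j) F"
  shows "((\<lambda>t. det (mat n n (\<lambda>(i, j). B t i j))) \<longlongrightarrow> det (mat n n (\<lambda>(i, j). C i j))) F"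
  unfolding det_mat_eq
  by (intro tendsto_sum tendsto_mult tendsto_const tendsto_prod assms) (auto simp: permutes_in_image)

section \<open>The Lax pair\<close>

text \<open>The classical Lax pair of the rational spin Calogero-Moser system, for null spins written as
  \<open>P (1, b) \<otimes> (- b, 1)\<close>. The diagonal of \<open>A\<close> accounts for the normalisation of the first spinor
  component.\<close>

definition lax_L :: "complex \<Rightarrow> (nat \<Rightarrow> complex) \<Rightarrow> (nat \<Rightarrow> complex) \<Rightarrow> (nat \<Rightarrow> complex) \<Rightarrow> (nat \<Rightarrow> complex)
    \<Rightarrow> nat \<Rightarrow> nat \<Rightarrow> complex"
  where "lax_L \<mu> P b x w j k =
    (if j = k then w j else \<mu> * P j * (b k - b j) / (x j - x k))"

definition lax_A :: "complex \<Rightarrow> nat set \<Rightarrow> (nat \<Rightarrow> complex) \<Rightarrow> (nat \<Rightarrow> complex) \<Rightarrow> (nat \<Rightarrow> complex)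
    \<Rightarrow> nat \<Rightarrow> nat \<Rightarrow> complex"
  where "lax_A \<mu> I P b x j k =
    (if j = k then - \<mu> * (\<Sum>l\<in>I - {j}. P l * (b j - b l) / (x j - x l)\<^sup>2)
     else \<mu> * P j * (b k - b j) / (x j - x k)\<^sup>2)"

text \<open>The summand \<open>l = j\<close> is a commutator of scalars; in every other summand the
  two products contribute equally, whence the factor 2. The result is the acceleration of the pole,
  since in frame coordinates \<open>4 * cdot (s j) (s l)\<close> is
  \<open>- 2 * P j * P l * (b j - b l)\<^sup>2\<close>. Later \<open>\<mu>\<close> is
  \<open>\<i>\<close> times the orientation of time.\<close>

lemma lax_commutator_diagonal:
  assumes I: "finite I" "j \<in> I" and x: "inj_on x I" and \<mu>: "\<mu>\<^sup>2 = -1"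
  shows "(\<Sum>l\<in>I. lax_A \<mu> I P b x j l * lax_L \<mu> P b x w l j - lax_L \<mu> P b x w j l * lax_A \<mu> I P b x l j)
    = - 2 * (\<Sum>l\<in>I - {j}. P j * P l * (b j - b l)\<^sup>2 / (x j - x l) ^ 3)"
proof -
  let ?c = "\<lambda>l. lax_A \<mu> I P b x j l * lax_L \<mu> P b x w l j - lax_L \<mu> P b x w j l * lax_A \<mu> I P b x l j"
  have "?c l = - 2 * (P j * P l * (b j - b l)\<^sup>2 / (x j - x l) ^ 3)" if l: "l \<in> I - {j}" for l
  proof -
  define d where "d = x j - x l"
  have d: "d \<noteq> 0" using l I x by (auto simp: d_def inj_on_def)
  have d': "x j - x l = d" "x l - x j = - d" by (auto simp: d_def)
  have "lax_A \<mu> I P b x j l * lax_L \<mu> P b x w l j - lax_L \<mu> P b x w j l * lax_A \<mu> I P b x l j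
    = \<mu>\<^sup>2 * (2 * (P j * P l * (b j - b l)\<^sup>2 / d ^ 3))"
    using l d by (auto simp: lax_A_def lax_L_def d' field_simps power2_eq_square power3_eq_cube)
  then show ?thesis
    by (simp add: \<mu> d')
  qed
  then have "sum ?c (I - {j}) = - 2 * (\<Sum>l\<in>I - {j}. P j * P l * (b j - b l)\<^sup>2 / (x j - x l) ^ 3)"
    unfolding sum_distrib_left by (intro sum.cong) auto
  moreover have "sum ?c I = ?c j + sum ?c (I - {j})"
    by (rule sum.remove[OF I])
  ultimately show ?thesis by simp
qed

text \<open>The right-hand side is the quotient rule for
  \<open>\<mu> * P j * (b k - b j) / (x j - x k)\<close> when the derivatives of \<open>P j\<close>,
  \<open>b m\<close> and \<open>x m\<close> are \<open>- 2 * \<mu> * P j * U j\<close>,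
  \<open>\<mu> * V m\<close> and \<open>w m\<close>. The terms with a third index \<open>l\<close>
  have to be rewritten as summands of \<open>U\<close> and \<open>V\<close>.\<close>

lemma lax_commutator_offdiagonal:
  fixes P b x :: "nat \<Rightarrow> complex"
  assumes I: "finite I" "j \<in> I" "k \<in> I" "j \<noteq> k" and x: "inj_on x I"
  defines "U m \<equiv> \<Sum>l\<in>I - {m}. P l * (b m - b l) / (x m - x l)\<^sup>2"
    and "V m \<equiv> \<Sum>l\<in>I - {m}. P l * (b m - b l)\<^sup>2 / (x m - x l)\<^sup>2"
  shows "(\<Sum>l\<in>I. lax_A \<mu> I P b x j l * lax_L \<mu> P b x w l k - lax_L \<mu> P b x w j l * lax_A \<mu> I P b x l k)
    = \<mu> * ((- 2 * \<mu> * P j * U j * (b k - b j) + P j * (\<mu> * V k - \<mu> * V j)) / (x j - x k)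
        - P j * (b k - b j) * (w j - w k) / (x j - x k)\<^sup>2)"
proof -
  define J where "J = I - {j, k}"
  have J: "I = insert j (insert k J)" "j \<notin> J" "k \<notin> J" "finite J" "I - {j} = insert k J" "I - {k} = insert j J"
    using I by (auto simp: J_def)
  define U1 U2 V1 V2 where
    "U1 = (\<Sum>l\<in>J. P l * (b j - b l) / (x j - x l)\<^sup>2)" and
    "U2 = (\<Sum>l\<in>J. P l * (b k - b l) / (x k - x l)\<^sup>2)" and
    "V1 = (\<Sum>l\<in>J. P l * (b j - b l)\<^sup>2 / (x j - x l)\<^sup>2)" and
    "V2 = (\<Sum>l\<in>J. P l * (b k - b l)\<^sup>2 / (x k - x l)\<^sup>2)"
  define d where "d = x j - x k"
  have d: "d \<noteq> 0" "x j - x k = d" "x k - x j = - d"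
    using I x by (auto simp: d_def inj_on_def)
  have UV: "U j = P k * (b j - b k) / d\<^sup>2 + U1" "U k = P j * (b k - b j) / d\<^sup>2 + U2"
    "V j = P k * (b j - b k)\<^sup>2 / d\<^sup>2 + V1" "V k = P j * (b k - b j)\<^sup>2 / d\<^sup>2 + V2"
    using J(2-4) d by (simp_all add: U_def V_def J(5,6) U1_def U2_def V1_def V2_def)
  have summand: "lax_A \<mu> I P b x j l * lax_L \<mu> P b x w l k - lax_L \<mu> P b x w j l * lax_A \<mu> I P b x l k
    = \<mu>\<^sup>2 * P j / d * (- (b k - b j) * (P l * (b j - b l) / (x j - x l)\<^sup>2) - P l * (b j - b l)\<^sup>2 / (x j - x l)\<^sup>2
      + P l * (b k - b l)\<^sup>2 / (x k - x l)\<^sup>2 - (b k - b j) * (P l * (b k - b l) / (x k - x l)\<^sup>2))"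
    if l: "l \<in> J" for l
  proof -
    define e f where "e = x j - x l" and "f = x k - x l"
    have "d = e - f" by (simp add: e_def f_def d_def)
    then have "e - f \<noteq> 0" using d(1) by simp
    have "x j \<noteq> x l" "x k \<noteq> x l"
      using l I x by (auto simp: J_def inj_on_eq_iff)
    then have e: "e \<noteq> 0" "x j - x l = e" and f: "f \<noteq> 0" "x k - x l = f" "x l - x k = - f"
      by (simp_all add: e_def f_def)
    have [simp]: "l \<noteq> j" "l \<noteq> k" "j \<noteq> l" "k \<noteq> l" using l J by auto
    have "lax_A \<mu> I P b x j l * lax_L \<mu> P b x w l k - lax_L \<mu> P b x w j l * lax_A \<mu> I P b x l k
      = \<mu>\<^sup>2 * P j * P l * ((b l - b j) * (b k - b l)) * (1 / e\<^sup>2 * (1 / - f) - 1 / e * (1 / f\<^sup>2))"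
      by (simp add: lax_A_def lax_L_def e(2) f(2,3))
        (simp add: algebra_simps power2_eq_square add_divide_distrib diff_divide_distrib)
    \<comment> \<open>Partial fractions with \<open>d = e - f\<close>: the dependence on
      \<open>x j - x l\<close> is separated from that on \<open>x k - x l\<close>.\<close>
    also have "1 / e\<^sup>2 * (1 / - f) - 1 / e * (1 / f\<^sup>2) = (1 / e\<^sup>2 - 1 / f\<^sup>2) / d"
      using e f \<open>e - f \<noteq> 0\<close> unfolding \<open>d = e - f\<close>
      by (simp add: divide_simps) (simp add: algebra_simps power2_eq_square)
    also have "\<mu>\<^sup>2 * P j * P l * ((b l - b j) * (b k - b l)) * ((1 / e\<^sup>2 - 1 / f\<^sup>2) / d) =
      \<mu>\<^sup>2 * P j / d * (P l * ((b l - b j) * (b k - b l)) * (1 / e\<^sup>2) - P l * ((b l - b j) * (b k - b l)) * (1 / f\<^sup>2))"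
      by (simp add: right_diff_distrib diff_divide_distrib mult_ac)
    \<comment> \<open>Writing \<open>b k - b l\<close> as \<open>(b k - b j) + (b j - b l)\<close>
      leaves only summands of \<open>U j\<close> and \<open>V j\<close>. The next step does the same
      around \<open>k\<close>, with \<open>b l - b j\<close> as
      \<open>(b k - b j) - (b k - b l)\<close>.\<close>
    also have "P l * ((b l - b j) * (b k - b l)) * (1 / e\<^sup>2)
       = - (b k - b j) * (P l * (b j - b l) / e\<^sup>2) - P l * (b j - b l)\<^sup>2 / e\<^sup>2"
      by (simp add: algebra_simps power2_eq_square add_divide_distrib diff_divide_distrib)
    also have "P l * ((b l - b j) * (b k - b l)) * (1 / f\<^sup>2)
       = - (P l * (b k - b l)\<^sup>2 / f\<^sup>2 - (b k - b j) * (P l * (b k - b l) / f\<^sup>2))"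
      by (simp add: algebra_simps power2_eq_square add_divide_distrib diff_divide_distrib)
    finally show ?thesis by (simp add: e f algebra_simps)
  qed
  have "(\<Sum>l\<in>J. lax_A \<mu> I P b x j l * lax_L \<mu> P b x w l k - lax_L \<mu> P b x w j l * lax_A \<mu> I P b x l k)
    = \<mu>\<^sup>2 * P j / d * (- (b k - b j) * U1 - V1 + V2 - (b k - b j) * U2)"
    unfolding U1_def U2_def V1_def V2_def
    by (subst sum.cong[OF refl summand], assumption)
       (simp only: sum_distrib_left[symmetric] sum.distrib sum_subtractf)
  moreover have "lax_A \<mu> I P b x j j = - \<mu> * U j" "lax_A \<mu> I P b x k k = - \<mu> * U k"
    by (simp_all add: lax_A_def U_def)
  moreover have "sum c I = c j + (c k + sum c J)" for c :: "nat \<Rightarrow> complex"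
    unfolding J(1) using J(2-4) I(4) by simp
  moreover have "lax_A \<mu> I P b x j k = \<mu> * P j * (b k - b j) / d\<^sup>2"
    "lax_L \<mu> P b x w j k = \<mu> * P j * (b k - b j) / d" "lax_L \<mu> P b x w j j = w j" "lax_L \<mu> P b x w k k = w k"
    using I(4) by (simp_all add: lax_A_def lax_L_def d)
  ultimately have "(\<Sum>l\<in>I. lax_A \<mu> I P b x j l * lax_L \<mu> P b x w l k - lax_L \<mu> P b x w j l * lax_A \<mu> I P b x l k)
    = - \<mu> * U j * (\<mu> * P j * (b k - b j) / d) - w j * (\<mu> * P j * (b k - b j) / d\<^sup>2)
      + (\<mu> * P j * (b k - b j) / d\<^sup>2 * w k + \<mu> * P j * (b k - b j) / d * (\<mu> * U k))
      + \<mu>\<^sup>2 * P j / d * (- (b k - b j) * U1 - V1 + V2 - (b k - b j) * U2)"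
    by simp
  also have "\<dots> = \<mu> * ((- 2 * \<mu> * P j * U j * (b k - b j) + P j * (\<mu> * V k - \<mu> * V j)) / d
        - P j * (b k - b j) * (w j - w k) / d\<^sup>2)"
    unfolding UV
    by (simp add: algebra_simps power2_eq_square add_divide_distrib diff_divide_distrib)
  finally show ?thesis by (simp add: d)
qed

lemma has_vector_derivative_divide_complex:
  fixes f g :: "real \<Rightarrow> complex"
  assumes f: "(f has_vector_derivative f') (at t)" and g: "(g has_vector_derivative g') (at t)" and "g t \<noteq> 0"
  shows "((\<lambda>s. f s / g s) has_vector_derivative (f' / g t - f t * g' / (g t)\<^sup>2)) (at t)"
proof -
  have "((\<lambda>z. inverse z) has_field_derivative - (inverse (g t) ^ Suc (Suc 0))) (at (g t))"
    by (rule DERIV_inverse) fact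
  from field_vector_diff_chain_at[OF g this]
  have "((\<lambda>s. inverse (g s)) has_vector_derivative g' * - (inverse (g t) ^ Suc (Suc 0))) (at t)"
    by (simp add: o_def)
  from has_vector_derivative_mult[OF f this] show ?thesis
    by (simp add: divide_inverse power2_eq_square algebra_simps)
qed

lemma lax_L_flow:
  fixes x w P b :: "nat \<Rightarrow> real \<Rightarrow> complex"
  assumes I: "finite I" "j \<in> I" "k \<in> I" and inj: "inj_on (\<lambda>l. x l t) I" and \<mu>: "\<mu>\<^sup>2 = -1"
    and x: "\<And>l. l \<in> I \<Longrightarrow> (x l has_vector_derivative w l t) (at t)"
    and w: "\<And>l. l \<in> I \<Longrightarrow> (w l has_vector_derivative
      - 2 * (\<Sum>i\<in>I - {l}. P l t * P i t * (b l t - b i t)\<^sup>2 / (x l t - x i t) ^ 3)) (at t)"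
    and P: "\<And>l. l \<in> I \<Longrightarrow> (P l has_vector_derivative
      - 2 * \<mu> * P l t * (\<Sum>i\<in>I - {l}. P i t * (b l t - b i t) / (x l t - x i t)\<^sup>2)) (at t)"
    and b: "\<And>l. l \<in> I \<Longrightarrow> (b l has_vector_derivative
      \<mu> * (\<Sum>i\<in>I - {l}. P i t * (b l t - b i t)\<^sup>2 / (x l t - x i t)\<^sup>2)) (at t)"
  defines "L \<equiv> \<lambda>s. lax_L \<mu> (\<lambda>l. P l s) (\<lambda>l. b l s) (\<lambda>l. x l s) (\<lambda>l. w l s)"
    and "A \<equiv> lax_A \<mu> I (\<lambda>l. P l t) (\<lambda>l. b l t) (\<lambda>l. x l t)"
  shows "((\<lambda>s. L s j k) has_vector_derivative (\<Sum>l\<in>I. A j l * L t l k - L t j l * A l k)) (at t)"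
proof (cases "j = k")
  case True
  have "(\<lambda>s. L s j k) = w j"
    by (auto simp: L_def lax_L_def True)
  then show ?thesis
    unfolding True using w[OF I(3)]
    unfolding A_def L_def lax_commutator_diagonal[OF I(1,3) inj \<mu>] by simp
next
  case False
  define d where "d = x j t - x k t"
  have d: "d \<noteq> 0" using inj_onD[OF inj _ I(2,3)] False by (auto simp: d_def)
  have L_jk: "(\<lambda>s. L s j k) = (\<lambda>s. \<mu> * (P j s * (b k s - b j s)) / (x j s - x k s))"
    using False by (auto simp: L_def lax_L_def)
  have xd: "((\<lambda>s. x j s - x k s) has_vector_derivative w j t - w k t) (at t)"
    by (intro has_vector_derivative_diff x I)
  note mult = has_vector_derivative_mult_right[OF has_vector_derivative_mult[OF P[OF I(2)]
        has_vector_derivative_diff[OF b[OF I(3)] b[OF I(2)]]], of \<mu>]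
  have "x j t - x k t \<noteq> 0" using d by (simp add: d_def)
  note deriv = has_vector_derivative_divide_complex[OF mult xd this]
  show ?thesis
    unfolding L_jk unfolding A_def L_def lax_commutator_offdiagonal[OF I False inj]
    by (rule has_vector_derivative_eq_rhs[OF deriv])
      (simp add: algebra_simps diff_divide_distrib add_divide_distrib)
qed

text \<open>Let X be the diagonal matrix of the poles. Then X' = L + [A, X] and L' = [A, L], so for
  fixed \<open>t\<^sub>1\<close> the matrix X + (\<open>t\<^sub>1\<close> - t) L has derivative
  [A, X + (\<open>t\<^sub>1\<close> - t) L]: the term L in X' cancels against the derivative of the
  scalar factor. Its spectrum is thus constant. At time 0 it is built from initial data and affine
  in \<open>t\<^sub>1\<close>; at time \<open>t\<^sub>1\<close> it is X, whose eigenvalues are the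
  poles.\<close>

lemma pole_is_char_root:
  fixes x w P b :: "nat \<Rightarrow> real \<Rightarrow> complex"
  assumes T: "is_interval T" "0 \<in> T" "t\<^sub>1 \<in> T" and \<mu>: "\<mu>\<^sup>2 = -1" and j: "j \<in> {1..N}"
    and inj: "\<And>t. t \<in> T \<Longrightarrow> inj_on (\<lambda>l. x l t) {1..N}"
    and x: "\<And>t l. t \<in> T \<Longrightarrow> l \<in> {1..N} \<Longrightarrow> (x l has_vector_derivative w l t) (at t)"
    and w: "\<And>t l. t \<in> T \<Longrightarrow> l \<in> {1..N} \<Longrightarrow> (w l has_vector_derivative
      - 2 * (\<Sum>i\<in>{1..N} - {l}. P l t * P i t * (b l t - b i t)\<^sup>2 / (x l t - x i t) ^ 3)) (at t)"
    and P: "\<And>t l. t \<in> T \<Longrightarrow> l \<in> {1..N} \<Longrightarrow> (P l has_vector_derivative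
      - 2 * \<mu> * P l t * (\<Sum>i\<in>{1..N} - {l}. P i t * (b l t - b i t) / (x l t - x i t)\<^sup>2)) (at t)"
    and b: "\<And>t l. t \<in> T \<Longrightarrow> l \<in> {1..N} \<Longrightarrow> (b l has_vector_derivative
      \<mu> * (\<Sum>i\<in>{1..N} - {l}. P i t * (b l t - b i t)\<^sup>2 / (x l t - x i t)\<^sup>2)) (at t)"
  defines "L \<equiv> \<lambda>s. lax_L \<mu> (\<lambda>l. P l s) (\<lambda>l. b l s) (\<lambda>l. x l s) (\<lambda>l. w l s)"
  shows "det (mat N N (\<lambda>(i, k). (if i = k then x (Suc i) 0 else 0) + of_real t\<^sub>1 * L 0 (Suc i) (Suc k)
    - (if i = k then x j t\<^sub>1 else 0))) = 0"
proof -
  define z where "z = x j t\<^sub>1"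
  \<comment> \<open>\<open>Suc\<close> translates matrix indices, which start at 0, into pole
    indices, which start at 1. At \<open>s = t\<^sub>1\<close> the coefficient of \<open>L\<close>
    vanishes and the diagonal entry at \<open>j - 1\<close> is 0.\<close>
  define Y where "Y s i k = (if i = k then x (Suc i) s else 0) + of_real (t\<^sub>1 - s) * L s (Suc i) (Suc k)
    - (if i = k then z else 0)" for s i k
  define A where "A t = lax_A \<mu> {1..N} (\<lambda>l. P l t) (\<lambda>l. b l t) (\<lambda>l. x l t)" for t
  have flow: "((\<lambda>t. Y t i k) has_vector_derivative
      (\<Sum>l<N. A t (Suc i) (Suc l) * Y t l k - Y t i l * A t (Suc l) (Suc k))) (at t)"
    if "t \<in> T" "i < N" "k < N" for t i k
  proof -
    have mem: "Suc i \<in> {1..N}" "Suc k \<in> {1..N}" using that by auto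
    define c where "c = (\<Sum>l\<in>{1..N}. A t (Suc i) l * L t l (Suc k) - L t (Suc i) l * A t l (Suc k))"
    have L: "((\<lambda>s. L s (Suc i) (Suc k)) has_vector_derivative c) (at t)"
      unfolding L_def A_def c_def
      using that mem by (intro lax_L_flow \<mu> inj x w P b) auto
    have X: "((\<lambda>s. if i = k then x (Suc i) s else 0) has_vector_derivative (if i = k then w (Suc i) t else 0)) (at t)"
      using x[OF that(1) mem(1)] by auto
    have "((\<lambda>s. of_real (t\<^sub>1 - s)) has_vector_derivative - (1::complex)) (at t)"
      using has_vector_derivative_of_real[of "\<lambda>s. t\<^sub>1 - s" "-1" "at t"]
      by (auto intro!: derivative_eq_intros simp: has_real_derivative_iff_has_vector_derivative[symmetric])
    from has_vector_derivative_diff[OF has_vector_derivative_add[OF X has_vector_derivative_mult[OF this L]]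
        has_vector_derivative_const[of "if i = k then z else 0"]]
    have "((\<lambda>t. Y t i k) has_vector_derivative
      (if i = k then w (Suc i) t else 0) - L t (Suc i) (Suc k) + of_real (t\<^sub>1 - t) * c) (at t)"
      unfolding Y_def by (simp add: algebra_simps)
    also have "(if i = k then w (Suc i) t else 0) - L t (Suc i) (Suc k)
        = A t (Suc i) (Suc k) * (x (Suc k) t - z) - (x (Suc i) t - z) * A t (Suc i) (Suc k)"
    proof (cases "i = k")
      case False
      then have "x (Suc i) t \<noteq> x (Suc k) t"
        using inj_onD[OF inj[OF that(1)] _ mem] by auto
      moreover have "L t (Suc i) (Suc k) = A t (Suc i) (Suc k) * (x (Suc i) t - x (Suc k) t)"
        using False calculation by (simp add: L_def A_def lax_L_def lax_A_def power2_eq_square)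
      ultimately show ?thesis using False by (simp add: algebra_simps)
    qed (simp add: L_def lax_L_def algebra_simps)
    also have "c = (\<Sum>l<N. A t (Suc i) (Suc l) * L t (Suc l) (Suc k) - L t (Suc i) (Suc l) * A t (Suc l) (Suc k))"
      unfolding c_def by (rule sum.reindex_bij_witness[of _ Suc "\<lambda>l. l - 1"]) auto
    also have "A t (Suc i) (Suc k) * (x (Suc k) t - z) - (x (Suc i) t - z) * A t (Suc i) (Suc k)
      = (\<Sum>l<N. A t (Suc i) (Suc l) * (if l = k then x (Suc l) t - z else 0)
          - (if i = l then x (Suc i) t - z else 0) * A t (Suc l) (Suc k))"
      using that by (simp add: sum_subtractf if_distrib[where f="\<lambda>x. _ * x"] if_distrib[where f="\<lambda>x. x * _"] cong: if_cong)
    also have "\<dots> + of_real (t\<^sub>1 - t) * (\<Sum>l<N. A t (Suc i) (Suc l) * L t (Suc l) (Suc k) - L t (Suc i) (Suc l) * A t (Suc l) (Suc k))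
      = (\<Sum>l<N. A t (Suc i) (Suc l) * Y t l k - Y t i l * A t (Suc l) (Suc k))"
      unfolding sum_distrib_left sum.distrib[symmetric]
      by (intro sum.cong refl) (simp add: Y_def algebra_simps)
    finally show ?thesis .
  qed
  have "det (mat N N (\<lambda>(i, k). Y 0 i k)) = det (mat N N (\<lambda>(i, k). Y t\<^sub>1 i k))"
    using det_isospectral_flow_constant[OF T(1,2,3) flow] .
  also have "\<dots> = 0"
  proof -
    define D where "D = mat N N (\<lambda>(i, k). if i = k then x (Suc i) t\<^sub>1 - z else 0)"
    have "mat N N (\<lambda>(i, k). Y t\<^sub>1 i k) = D"
      unfolding D_def by (rule eq_matI) (auto simp: Y_def)
    moreover have "det D = prod_list (diag_mat D)"
      by (rule det_upper_triangular[of _ N]) (auto simp: D_def)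
    moreover have "0 \<in> set (diag_mat D)"
      using j by (auto simp: z_def D_def diag_mat_def image_iff intro!: bexI[of _ "j - 1"])
    ultimately show ?thesis by (simp add: prod_list_zero_iff)
  qed
  finally show ?thesis unfolding Y_def z_def diff_zero .
qed

section \<open>Null spins in a generic frame\<close>

text \<open>The coordinates of \<open>u\<close> are its bilinear products with a basis \<open>\<nu>, n, \<nu>'\<close> such that \<open>\<nu>\<close>, \<open>\<nu>'\<close> are
  null, \<open>\<nu> \<cdot> \<nu>' = 2\<close> and \<open>n\<close> is a unit vector orthogonal to both; the parameter \<open>c\<close> is that of a
  group of complex rotations fixing \<open>\<nu>'\<close>.\<close>

definition frame_P :: "complex \<Rightarrow> complex ^ 3 \<Rightarrow> complex"
  where "frame_P c u = u$1 - \<i> * u$2 + 2 * c * u$3 - c\<^sup>2 * (u$1 + \<i> * u$2)"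

definition frame_Q :: "complex \<Rightarrow> complex ^ 3 \<Rightarrow> complex"
  where "frame_Q c u = u$3 - c * (u$1 + \<i> * u$2)"

definition frame_R :: "complex ^ 3 \<Rightarrow> complex"
  where "frame_R u = u$1 + \<i> * u$2"

text \<open>For a null vector this is the ratio of its two spinor components, an affine coordinate
  on the conic of null directions; the direction with \<open>frame_P c u = 0\<close> is its point at
  infinity.\<close>

definition frame_b :: "complex \<Rightarrow> complex ^ 3 \<Rightarrow> complex"
  where "frame_b c u = - frame_Q c u / frame_P c u"

lemma cdot_frame:
  "cdot u v = (frame_P c u * frame_R v + frame_R u * frame_P c v) / 2 + frame_Q c u * frame_Q c v"
  by (simp add: cdot_def frame_P_def frame_Q_def frame_R_def field_simps power2_eq_square)

lemma ccross_frame: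
  "frame_P c (ccross u v) = \<i> * (frame_P c u * frame_Q c v - frame_Q c u * frame_P c v)"
  "frame_Q c (ccross u v) = - \<i> / 2 * (frame_P c u * frame_R v - frame_R u * frame_P c v)"
  by (simp_all add: ccross_def frame_P_def frame_Q_def frame_R_def field_simps power2_eq_square)

lemma null_frame:
  assumes "cdot u u = 0" "frame_P c u \<noteq> 0"
  shows "frame_Q c u = - frame_P c u * frame_b c u" "frame_R u = - frame_P c u * (frame_b c u)\<^sup>2"
proof -
  show Q: "frame_Q c u = - frame_P c u * frame_b c u"
    using assms(2) by (simp add: frame_b_def)
  have "frame_P c u * (frame_R u + frame_P c u * (frame_b c u)\<^sup>2) = 0"
    using assms(1) unfolding cdot_frame[of u u c] Q by (simp add: field_simps power2_eq_square)
  then show "frame_R u = - frame_P c u * (frame_b c u)\<^sup>2"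
    using assms(2) by (simp add: add_eq_0_iff)
qed

text \<open>The perfect square is the reason why a Lax matrix with entries linear in
  \<open>b k - b j\<close> can carry the interaction: the product of its entries at (j, k) and (k,
  j) is a multiple of \<open>cdot (s j) (s k) / (x j - x k)\<^sup>2\<close>.\<close>

lemma cdot_null_frame:
  assumes "cdot u u = 0" "frame_P c u \<noteq> 0" "cdot v v = 0" "frame_P c v \<noteq> 0"
  shows "cdot u v = - (frame_P c u * frame_P c v * (frame_b c u - frame_b c v)\<^sup>2) / 2"
  unfolding cdot_frame[of u v c] null_frame[OF assms(1,2)] null_frame[OF assms(3,4)]
  by (simp add: field_simps power2_eq_square)

lemma bounded_linear_frame_P: "bounded_linear (frame_P c)"
  unfolding frame_P_def
  by (intro bounded_linear_sub bounded_linear_add bounded_linear_const_mult bounded_linear_vec_nth)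

lemma bounded_linear_frame_Q: "bounded_linear (frame_Q c)"
  unfolding frame_Q_def
  by (intro bounded_linear_sub bounded_linear_add bounded_linear_const_mult bounded_linear_vec_nth)

lemma frame_scale:
  "frame_P c (a *s u) = a * frame_P c u" "frame_Q c (a *s u) = a * frame_Q c u"
  by (simp_all add: frame_P_def frame_Q_def algebra_simps)

lemma frame_sum:
  "frame_P c (sum f I) = (\<Sum>i\<in>I. frame_P c (f i))" "frame_Q c (sum f I) = (\<Sum>i\<in>I. frame_Q c (f i))"
  using linear_sum[OF bounded_linear.linear[OF bounded_linear_frame_P]]
    linear_sum[OF bounded_linear.linear[OF bounded_linear_frame_Q]] by auto

text \<open>The first and second frame coordinates of the spin equation follow by linearity, and the
  derivative of \<open>frame_b\<close> by the quotient rule. There the terms with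
  \<open>2 * b j * U\<close> cancel, so that P and b form a closed system, the one required by the
  Lax equation.\<close>

lemma spin_frame_flow:
  fixes s :: "nat \<Rightarrow> real \<Rightarrow> complex ^ 3" and x :: "nat \<Rightarrow> complex" and \<sigma> :: real
  assumes j: "j \<in> I"
    and s: "(s j has_vector_derivative
      of_real (- 2 * \<sigma>) *s (\<Sum>k\<in>I - {j}. (1 / (x j - x k)\<^sup>2) *s ccross (s j t) (s k t))) (at t)"
    and null: "\<And>k. k \<in> I \<Longrightarrow> cdot (s k t) (s k t) = 0"
    and P: "\<And>k. k \<in> I \<Longrightarrow> frame_P c (s k t) \<noteq> 0"
  defines "p \<equiv> \<lambda>k. frame_P c (s k t)" and "b \<equiv> \<lambda>k. frame_b c (s k t)"
  shows "((\<lambda>t. frame_P c (s j t)) has_vector_derivative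
      - 2 * (\<i> * of_real \<sigma>) * p j * (\<Sum>k\<in>I - {j}. p k * (b j - b k) / (x j - x k)\<^sup>2)) (at t)"
    and "((\<lambda>t. frame_b c (s j t)) has_vector_derivative
      (\<i> * of_real \<sigma>) * (\<Sum>k\<in>I - {j}. p k * (b j - b k)\<^sup>2 / (x j - x k)\<^sup>2)) (at t)"
proof -
  define U where "U = (\<Sum>k\<in>I - {j}. p k * (b j - b k) / (x j - x k)\<^sup>2)"
  define V where "V = (\<Sum>k\<in>I - {j}. p k * (b j - b k)\<^sup>2 / (x j - x k)\<^sup>2)"
  have frame: "frame_P c (s k t) = p k" "frame_Q c (s k t) = - p k * b k" "frame_R (s k t) = - p k * (b k)\<^sup>2"
    if "k \<in> I" for k
    using null_frame[OF null P, OF that that] by (simp_all add: p_def b_def)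
  have [simp]: "p j \<noteq> 0" using P j by (simp add: p_def)
  have P': "frame_P c (of_real (- 2 * \<sigma>) *s (\<Sum>k\<in>I - {j}. (1 / (x j - x k)\<^sup>2) *s ccross (s j t) (s k t)))
    = - 2 * (\<i> * of_real \<sigma>) * p j * U"
    unfolding frame_scale frame_sum ccross_frame U_def sum_distrib_left
  proof (intro sum.cong refl)
    fix k assume "k \<in> I - {j}"
    then have k: "k \<in> I" by simp
    show "of_real (- 2 * \<sigma>) * (1 / (x j - x k)\<^sup>2 * (\<i> * (frame_P c (s j t) * frame_Q c (s k t) - frame_Q c (s j t) * frame_P c (s k t))))
      = - 2 * (\<i> * of_real \<sigma>) * p j * (p k * (b j - b k) / (x j - x k)\<^sup>2)"
      unfolding frame[OF j] frame[OF k] by (simp add: divide_inverse algebra_simps)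
  qed
  have "frame_Q c (of_real (- 2 * \<sigma>) *s (\<Sum>k\<in>I - {j}. (1 / (x j - x k)\<^sup>2) *s ccross (s j t) (s k t)))
    = \<i> * of_real \<sigma> * p j * (\<Sum>k\<in>I - {j}. 2 * b j * (p k * (b j - b k) / (x j - x k)\<^sup>2) - p k * (b j - b k)\<^sup>2 / (x j - x k)\<^sup>2)"
    unfolding frame_scale frame_sum ccross_frame sum_distrib_left
  proof (intro sum.cong refl)
    fix k assume "k \<in> I - {j}"
    then have k: "k \<in> I" by simp
    define D where "D = inverse ((x j - x k)\<^sup>2)"
    \<comment> \<open>Up to common factors this is \<open>(b j)\<^sup>2 - (b k)\<^sup>2 = 2 * b j *
      (b j - b k) - (b j - b k)\<^sup>2\<close>.\<close>
    show "of_real (- 2 * \<sigma>) * (1 / (x j - x k)\<^sup>2 * (- \<i> / 2 * (frame_P c (s j t) * frame_R (s k t) - frame_R (s j t) * frame_P c (s k t))))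
      = \<i> * of_real \<sigma> * p j * (2 * b j * (p k * (b j - b k) / (x j - x k)\<^sup>2) - p k * (b j - b k)\<^sup>2 / (x j - x k)\<^sup>2)"
      unfolding frame[OF j] frame[OF k] divide_inverse D_def[symmetric]
      by (simp add: algebra_simps power2_eq_square)
  qed
  then have Q': "frame_Q c (of_real (- 2 * \<sigma>) *s (\<Sum>k\<in>I - {j}. (1 / (x j - x k)\<^sup>2) *s ccross (s j t) (s k t)))
    = \<i> * of_real \<sigma> * p j * (2 * b j * U - V)"
    by (simp add: U_def V_def sum_subtractf sum_distrib_left)
  have dP: "((\<lambda>t. frame_P c (s j t)) has_vector_derivative - 2 * (\<i> * of_real \<sigma>) * p j * U) (at t)"
    using bounded_linear.has_vector_derivative[OF bounded_linear_frame_P s, of c] unfolding P' .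
  then show "((\<lambda>t. frame_P c (s j t)) has_vector_derivative
      - 2 * (\<i> * of_real \<sigma>) * p j * (\<Sum>k\<in>I - {j}. p k * (b j - b k) / (x j - x k)\<^sup>2)) (at t)"
    unfolding U_def .
  have dQ: "((\<lambda>t. frame_Q c (s j t)) has_vector_derivative \<i> * of_real \<sigma> * p j * (2 * b j * U - V)) (at t)"
    using bounded_linear.has_vector_derivative[OF bounded_linear_frame_Q s, of c] unfolding Q' .
  have "((\<lambda>t. - frame_Q c (s j t) / frame_P c (s j t)) has_vector_derivative
      (- (\<i> * of_real \<sigma> * p j * (2 * b j * U - V)) / p j
        - (- (- p j * b j)) * (- 2 * (\<i> * of_real \<sigma>) * p j * U) / (p j)\<^sup>2)) (at t)"
    using has_vector_derivative_divide_complex[OF has_vector_derivative_minus[OF dQ] dP P[OF j]]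
    unfolding frame[OF j] .
  also have "- (\<i> * of_real \<sigma> * p j * (2 * b j * U - V)) / p j
        - (- (- p j * b j)) * (- 2 * (\<i> * of_real \<sigma>) * p j * U) / (p j)\<^sup>2 = \<i> * of_real \<sigma> * V"
    by (simp add: power2_eq_square algebra_simps add_divide_distrib diff_divide_distrib)
  finally show "((\<lambda>t. frame_b c (s j t)) has_vector_derivative
      (\<i> * of_real \<sigma>) * (\<Sum>k\<in>I - {j}. p k * (b j - b k)\<^sup>2 / (x j - x k)\<^sup>2)) (at t)"
    unfolding V_def frame_b_def .
qed

text \<open>A value \<open>c\<close> is excluded by the spin \<open>s j t\<close> only if it is the value at \<open>t\<close> of a certain
  differentiable function of real time, and such a function does not fill the complex plane.\<close>

lemma generic_frame:
  fixes s :: "nat \<Rightarrow> real \<Rightarrow> complex ^ 3"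
  assumes "finite I"
    and diff: "\<And>j t. j \<in> I \<Longrightarrow> t \<in> T \<Longrightarrow> (s j has_vector_derivative s' j t) (at t)"
    and null: "\<And>j t. j \<in> I \<Longrightarrow> t \<in> T \<Longrightarrow> cdot (s j t) (s j t) = 0"
    and nonzero: "\<And>j t. j \<in> I \<Longrightarrow> t \<in> T \<Longrightarrow> s j t \<noteq> 0"
  obtains c where "\<And>j t. j \<in> I \<Longrightarrow> t \<in> T \<Longrightarrow> frame_P c (s j t) \<noteq> 0"
proof -
  \<comment> \<open>For a null spin, \<open>frame_P c u = 0\<close> forces
    \<open>frame_Q c u = 0\<close>, that is, \<open>u $ 3 = c * frame_R u\<close>. Where
    \<open>frame_R\<close> is nonzero, the excluded value is thus \<open>g j t\<close>; where it
    vanishes, a nonzero null spin excludes no \<open>c\<close>.\<close>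
  define S where "S j = {t \<in> T. frame_R (s j t) \<noteq> 0}" for j
  define g where "g j t = s j t $ 3 / frame_R (s j t)" for j t
  have "bounded_linear frame_R"
    unfolding frame_R_def by (intro bounded_linear_add bounded_linear_const_mult bounded_linear_vec_nth)
  have "g j differentiable at t" if "j \<in> I" "t \<in> S j" for j t
  proof -
    have t: "t \<in> T" "frame_R (s j t) \<noteq> 0" using that(2) by (auto simp: S_def)
    note d = diff[OF that(1) t(1)]
    show ?thesis
      unfolding g_def
      by (rule differentiableI_vector[OF has_vector_derivative_divide_complex[OF
            bounded_linear.has_vector_derivative[OF bounded_linear_vec_nth d]
            bounded_linear.has_vector_derivative[OF \<open>bounded_linear frame_R\<close> d] t(2)]])
  qed
  then have "g j differentiable_on S j" if "j \<in> I" for j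
    unfolding differentiable_on_def using that differentiable_at_withinI by blast
  then have "negligible (g j ` S j)" if "j \<in> I" for j
    using that by (intro negligible_differentiable_image_lowdim) auto
  then have "negligible (\<Union>j\<in>I. g j ` S j)"
    using \<open>finite I\<close> by (intro negligible_Union) auto
  then obtain c where c: "c \<notin> (\<Union>j\<in>I. g j ` S j)"
    using non_negligible_UNIV by (metis UNIV_eq_I)
  have "frame_P c (s j t) \<noteq> 0" if j: "j \<in> I" and t: "t \<in> T" for j t
  proof
    assume P: "frame_P c (s j t) = 0"
    then have "frame_Q c (s j t) = 0"
      using null[OF j t] by (simp add: cdot_frame[of _ _ c])
    then have Q: "s j t $ 3 = c * frame_R (s j t)"
      by (simp add: frame_Q_def frame_R_def)
    show False
    proof (cases "frame_R (s j t) = 0")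
      case True
      then have plus: "s j t $ 1 + \<i> * s j t $ 2 = 0" by (simp add: frame_R_def)
      have "s j t $ 3 = 0" using Q True by simp
      with P plus have minus: "s j t $ 1 - \<i> * s j t $ 2 = 0" by (simp add: frame_P_def)
      have "s j t $ 1 = 0" "s j t $ 2 = 0"
        using arg_cong2[OF plus minus, of "(+)"] arg_cong2[OF plus minus, of "(-)"] by simp_all
      with \<open>s j t $ 3 = 0\<close> have "s j t = 0"
        by (simp add: Finite_Cartesian_Product.vec_eq_iff forall_3)
      with nonzero[OF j t] show False by simp
    next
      case False
      with t Q have "t \<in> S j" "c = g j t" by (auto simp: S_def g_def)
      with c j show False by blast
    qed
  qed
  then show ?thesis using that by blast
qed

section \<open>Convergence of the poles\<close>

text \<open>Suppose that \<open>f\<close> stays close to \<open>l\<close> along \<open>u\<close> but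
  at distance at least \<open>\<epsilon>\<close> along \<open>v\<close>. On the segments from
  \<open>u n\<close> to \<open>v n\<close>, which shrink to \<open>t\<^sub>0\<close>, the distance
  to \<open>l\<close> takes each value \<open>\<rho>\<close> between 0 and
  \<open>\<epsilon>\<close>, so by compactness there is a cluster value at distance exactly
  \<open>\<rho>\<close>. A finite \<open>Z\<close> allows this for finitely many
  \<open>\<rho>\<close> only.\<close>

lemma tendsto_of_finite_cluster_set:
  fixes f :: "real \<Rightarrow> 'a::euclidean_space"
  assumes T: "is_interval T" "t\<^sub>0 \<in> closure T" and cont: "continuous_on T f" and bdd: "bounded (f ` T)"
    and Z: "finite Z" "\<And>u \<zeta>. range u \<subseteq> T \<Longrightarrow> u \<longlonglongrightarrow> t\<^sub>0 \<Longrightarrow> (\<lambda>n. f (u n)) \<longlonglongrightarrow> \<zeta> \<Longrightarrow> \<zeta> \<in> Z"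
  shows "\<exists>l. (f \<longlongrightarrow> l) (at t\<^sub>0 within T)"
proof -
  have cluster: "\<exists>r \<zeta>. strict_mono (r :: nat \<Rightarrow> nat) \<and> (\<lambda>n. f (u (r n))) \<longlonglongrightarrow> \<zeta> \<and> (\<lambda>n. u (r n)) \<longlonglongrightarrow> t\<^sub>0 \<and> \<zeta> \<in> Z"
    if u: "range u \<subseteq> T" "u \<longlonglongrightarrow> t\<^sub>0" for u
  proof -
    have "bounded (range (f \<circ> u))"
      using bdd by (rule bounded_subset) (use u in auto)
    then obtain \<zeta> r where r: "strict_mono r" "((f \<circ> u) \<circ> r) \<longlonglongrightarrow> \<zeta>"
      using bounded_imp_convergent_subsequence by blast
    have "(u \<circ> r) \<longlonglongrightarrow> t\<^sub>0"
      using u(2) r(1) by (rule LIMSEQ_subseq_LIMSEQ)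
    moreover have "\<zeta> \<in> Z"
      by (rule Z(2)[of "u \<circ> r"]) (use r u(1) calculation in \<open>auto simp: o_def\<close>)
    ultimately show ?thesis
      using r by (intro exI[of _ r] exI[of _ \<zeta>]) (auto simp: o_def)
  qed
  obtain u\<^sub>0 where "range u\<^sub>0 \<subseteq> T" "u\<^sub>0 \<longlonglongrightarrow> t\<^sub>0"
    using T(2) unfolding closure_sequential by blast
  from cluster[OF this] obtain r l where r: "(\<lambda>n. f (u\<^sub>0 (r n))) \<longlonglongrightarrow> l" "(\<lambda>n. u\<^sub>0 (r n)) \<longlonglongrightarrow> t\<^sub>0"
    by blast
  define u where "u = (\<lambda>n. u\<^sub>0 (r n))"
  have u: "u n \<in> T" "u \<longlonglongrightarrow> t\<^sub>0" "(\<lambda>n. f (u n)) \<longlonglongrightarrow> l" for n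
    using r \<open>range u\<^sub>0 \<subseteq> T\<close> by (auto simp: u_def)
  have "(f \<longlongrightarrow> l) (at t\<^sub>0 within T)"
  proof (rule ccontr)
    assume "\<not> (f \<longlongrightarrow> l) (at t\<^sub>0 within T)"
    then obtain \<epsilon> where \<epsilon>: "\<epsilon> > 0" "\<And>d. d > 0 \<Longrightarrow> \<exists>v\<in>T. dist v t\<^sub>0 < d \<and> \<epsilon> \<le> dist (f v) l"
      unfolding Lim_within by (meson not_less)
    have "\<exists>v\<in>T. dist v t\<^sub>0 < inverse (real (Suc n)) \<and> \<epsilon> \<le> dist (f v) l" for n
      by (rule \<epsilon>(2)) simp
    then obtain v where v: "\<And>n. v n \<in> T" "\<And>n. dist (v n) t\<^sub>0 < inverse (real (Suc n))" "\<And>n. \<epsilon> \<le> dist (f (v n)) l"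
      by metis
    have "(\<lambda>n. dist (v n) t\<^sub>0) \<longlonglongrightarrow> 0"
      by (rule tendsto_sandwich[OF _ _ tendsto_const LIMSEQ_inverse_real_of_nat])
        (rule always_eventually, rule allI, rule zero_le_dist less_imp_le[OF v(2)])+
    then have v_lim: "v \<longlonglongrightarrow> t\<^sub>0"
      using tendsto_dist_iff[of v t\<^sub>0 sequentially] by blast
    have "infinite ({0<..<\<epsilon>} - (\<lambda>\<zeta>. dist \<zeta> l) ` Z)"
      using \<epsilon>(1) Z(1) by (intro Diff_infinite_finite) auto
    then obtain \<rho> where \<rho>: "0 < \<rho>" "\<rho> < \<epsilon>" "\<rho> \<notin> (\<lambda>\<zeta>. dist \<zeta> l) ` Z"
      by (metis DiffE finite.emptyI ex_in_conv greaterThanLessThan_iff)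
    have "\<forall>\<^sub>F n in sequentially. dist (f (u n)) l < \<rho>"
      using u(3) \<rho>(1) by (rule tendstoD)
    then obtain n\<^sub>0 where n\<^sub>0: "\<And>n. n \<ge> n\<^sub>0 \<Longrightarrow> dist (f (u n)) l < \<rho>"
      by (auto simp: eventually_sequentially)
    have "\<exists>y\<in>closed_segment (u n) (v n). dist (f y) l = \<rho>" if "n \<ge> n\<^sub>0" for n
    proof -
      have sub: "closed_segment (u n) (v n) \<subseteq> T"
        using T(1) u(1) v(1) by (simp add: closed_segment_subset is_interval_convex_1)
      have "connected ((\<lambda>y. dist (f y) l) ` closed_segment (u n) (v n))"
        by (intro connected_continuous_image continuous_intros continuous_on_subset[OF cont] sub) auto
      then have "\<rho> \<in> (\<lambda>y. dist (f y) l) ` closed_segment (u n) (v n)"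
        using n\<^sub>0[OF that] v(3)[of n] \<rho>(2)
        by (auto elim!: connectedD_interval[where x = "dist (f (u n)) l" and y = "dist (f (v n)) l"])
      then show ?thesis by auto
    qed
    then have "\<forall>n. \<exists>y. y \<in> closed_segment (u (n + n\<^sub>0)) (v (n + n\<^sub>0)) \<and> dist (f y) l = \<rho>"
      by (meson le_add2)
    from choice[OF this] obtain y where
      y: "\<And>n. y n \<in> closed_segment (u (n + n\<^sub>0)) (v (n + n\<^sub>0))" "\<And>n. dist (f (y n)) l = \<rho>"
      by blast
    have "y n \<in> T" for n
      using y(1)[of n] T(1) u(1) v(1) closed_segment_subset[of "u (n + n\<^sub>0)" T "v (n + n\<^sub>0)"]
      by (auto simp: is_interval_convex_1)
    moreover have "y \<longlonglongrightarrow> t\<^sub>0"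
    proof -
      have lim: "(\<lambda>n. u (n + n\<^sub>0)) \<longlonglongrightarrow> t\<^sub>0" "(\<lambda>n. v (n + n\<^sub>0)) \<longlonglongrightarrow> t\<^sub>0"
        by (intro LIMSEQ_ignore_initial_segment u v_lim)+
      have "(\<lambda>n. min (u (n + n\<^sub>0)) (v (n + n\<^sub>0))) \<longlonglongrightarrow> t\<^sub>0" "(\<lambda>n. max (u (n + n\<^sub>0)) (v (n + n\<^sub>0))) \<longlonglongrightarrow> t\<^sub>0"
        using tendsto_min[OF lim] tendsto_max[OF lim] by simp_all
      moreover have "min (u (n + n\<^sub>0)) (v (n + n\<^sub>0)) \<le> y n" "y n \<le> max (u (n + n\<^sub>0)) (v (n + n\<^sub>0))" for n
        using y(1)[of n] by (auto simp: closed_segment_eq_real_ivl split: if_splits)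
      ultimately show ?thesis
        by (intro tendsto_sandwich[of "\<lambda>n. min (u (n + n\<^sub>0)) (v (n + n\<^sub>0))" y _ "\<lambda>n. max (u (n + n\<^sub>0)) (v (n + n\<^sub>0))"])
          auto
    qed
    ultimately obtain r' \<zeta> where \<zeta>: "strict_mono (r' :: nat \<Rightarrow> nat)" "(\<lambda>n. f (y (r' n))) \<longlonglongrightarrow> \<zeta>" "\<zeta> \<in> Z"
      using cluster[of y] by blast
    have "(\<lambda>n. dist (f (y (r' n))) l) \<longlonglongrightarrow> dist \<zeta> l"
      by (intro tendsto_intros \<zeta>(2))
    then have "dist \<zeta> l = \<rho>"
      unfolding y(2) by (simp add: LIMSEQ_const_iff)
    with \<rho>(3) \<zeta>(3) show False by blast
  qed
  then show ?thesis by blast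
qed

text \<open>A cluster value of \<open>f\<close> at \<open>t\<^sub>0\<close> is a root of the
  characteristic polynomial at \<open>t\<^sub>0\<close>, hence one of finitely many. Boundedness
  comes from the matrix entries, which is why \<open>T\<close> is first cut down to times within
  distance 1 of \<open>t\<^sub>0\<close>.\<close>

lemma root_curve_converges:
  fixes X L :: "nat \<Rightarrow> nat \<Rightarrow> complex"
  assumes T: "is_interval T" "t\<^sub>0 \<in> closure T" and cont: "continuous_on T f"
    and root: "\<And>t. t \<in> T \<Longrightarrow>
      det (mat n n (\<lambda>(i, k). X i k + of_real t * L i k - (if i = k then f t else 0))) = 0"
  shows "\<exists>l. (f \<longlongrightarrow> l) (at t\<^sub>0 within T)"
proof -
  define S where "S = T \<inter> ball t\<^sub>0 1"
  define Z where "Z = {z. det (mat n n (\<lambda>(i, k). X i k + of_real t\<^sub>0 * L i k - (if i = k then z else 0))) = 0}"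
  have "bounded (f ` S)"
  proof -
    define K where "K = (\<Sum>i<n. \<Sum>k<n. cmod (X i k) + (\<bar>t\<^sub>0\<bar> + 1) * cmod (L i k))"
    have "cmod (f t) \<le> n * K" if t: "t \<in> S" for t
    proof (rule char_root_bound)
      show "det (mat n n (\<lambda>(i, k). X i k + of_real t * L i k - (if i = k then f t else 0))) = 0"
        using t by (intro root) (auto simp: S_def)
      fix i k assume ik: "i < n" "k < n"
      have "\<bar>t\<bar> \<le> \<bar>t\<^sub>0\<bar> + 1" using t by (auto simp: S_def dist_real_def)
      then have "cmod (X i k + of_real t * L i k) \<le> cmod (X i k) + (\<bar>t\<^sub>0\<bar> + 1) * cmod (L i k)"
        by (intro norm_triangle_le add_left_mono) (auto simp: norm_mult intro: mult_right_mono)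
      also have "\<dots> \<le> (\<Sum>k<n. cmod (X i k) + (\<bar>t\<^sub>0\<bar> + 1) * cmod (L i k))"
        using ik by (intro member_le_sum) auto
      also have "\<dots> \<le> K"
        unfolding K_def using ik
        by (intro member_le_sum[where f = "\<lambda>i. \<Sum>k<n. cmod (X i k) + (\<bar>t\<^sub>0\<bar> + 1) * cmod (L i k)"] sum_nonneg) auto
      finally show "cmod (X i k + of_real t * L i k) \<le> K" .
    qed
    then show ?thesis by (auto simp: bounded_iff)
  qed
  moreover have "\<zeta> \<in> Z" if u: "range u \<subseteq> S" "u \<longlonglongrightarrow> t\<^sub>0" "(\<lambda>m. f (u m)) \<longlonglongrightarrow> \<zeta>" for u \<zeta>
  proof -
    have "(\<lambda>m. det (mat n n (\<lambda>(i, k). X i k + of_real (u m) * L i k - (if i = k then f (u m) else 0))))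
      \<longlonglongrightarrow> det (mat n n (\<lambda>(i, k). X i k + of_real t\<^sub>0 * L i k - (if i = k then \<zeta> else 0)))"
      using u(3) by (intro tendsto_det) (auto intro!: tendsto_intros u(2))
    moreover have "det (mat n n (\<lambda>(i, k). X i k + of_real (u m) * L i k - (if i = k then f (u m) else 0))) = 0" for m
      using u(1) by (intro root) (auto simp: S_def)
    ultimately show ?thesis
      unfolding Z_def by (simp add: LIMSEQ_const_iff)
  qed
  moreover have "finite Z" unfolding Z_def by (rule finite_char_roots)
  moreover have "is_interval S"
    unfolding S_def by (intro is_interval_Int T is_interval_ball_real)
  moreover have "t\<^sub>0 \<in> closure S"
    unfolding S_def using T(2) open_Int_closure_subset[of "ball t\<^sub>0 1" T] by (auto simp: Int_commute)
  moreover have "continuous_on S f"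
    using cont by (rule continuous_on_subset) (simp add: S_def)
  ultimately have "\<exists>l. (f \<longlongrightarrow> l) (at t\<^sub>0 within S)"
    using tendsto_of_finite_cluster_set[of S t\<^sub>0 f Z] by blast
  moreover have "at t\<^sub>0 within S = at t\<^sub>0 within T"
    by (rule at_within_nhd[of _ "ball t\<^sub>0 1"]) (auto simp: S_def)
  ultimately show ?thesis by simp
qed

section \<open>Spins are controlled by the heights of their poles\<close>

text \<open>Induction on the nodes: p(\<zeta>) = (\<zeta> - h) q(\<zeta>) + p(h) with q of smaller
  degree, and q(\<eta>) = (p(\<eta>) - p(h)) / (\<eta> - h) at the other nodes. Collecting the
  coefficients gives the new weights.\<close>

lemma lagrange_weights:
  fixes \<zeta> :: "'a::field"
  assumes "finite H"
  shows "\<exists>c. \<forall>p. degree p < card H \<longrightarrow> poly p \<zeta> = (\<Sum>\<eta>\<in>H. c \<eta> * poly p \<eta>)"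
  using assms
proof (induction H)
  case (insert h H)
  then obtain c where c: "\<And>p. degree p < card H \<Longrightarrow> poly p \<zeta> = (\<Sum>\<eta>\<in>H. c \<eta> * poly p \<eta>)"
    by blast
  define c' where "c' \<eta> = (if \<eta> = h then 1 - (\<zeta> - h) * (\<Sum>\<eta>\<in>H. c \<eta> / (\<eta> - h))
    else (\<zeta> - h) * (c \<eta> / (\<eta> - h)))" for \<eta>
  have "poly p \<zeta> = (\<Sum>\<eta>\<in>insert h H. c' \<eta> * poly p \<eta>)" if p: "degree p < card (insert h H)" for p
  proof -
    define q where "q = synthetic_div p h"
    have split: "poly p \<eta> = (\<eta> - h) * poly q \<eta> + poly p h" for \<eta>
      using arg_cong[OF synthetic_div_correct'[of h p], of "\<lambda>r. poly r \<eta>"] by (simp add: q_def algebra_simps)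
    have q: "poly q \<zeta> = (\<Sum>\<eta>\<in>H. c \<eta> * poly q \<eta>)"
    proof (cases "H = {}")
      case True
      with p have "q = 0" by (simp add: q_def synthetic_div_eq_0_iff)
      with True show ?thesis by simp
    next
      case False
      with insert.hyps have "card H > 0" by (simp add: card_gt_0_iff)
      with insert.hyps p show ?thesis
        by (intro c) (auto simp: q_def degree_synthetic_div)
    qed
    have "(\<Sum>\<eta>\<in>H. c' \<eta> * poly p \<eta>) = (\<Sum>\<eta>\<in>H. (\<zeta> - h) * (c \<eta> * poly q \<eta>) + (\<zeta> - h) * (c \<eta> / (\<eta> - h)) * poly p h)"
    proof (intro sum.cong refl)
      fix \<eta> assume "\<eta> \<in> H"
      with insert.hyps have "\<eta> \<noteq> h" by auto
      then show "c' \<eta> * poly p \<eta> = (\<zeta> - h) * (c \<eta> * poly q \<eta>) + (\<zeta> - h) * (c \<eta> / (\<eta> - h)) * poly p h"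
        unfolding split[of \<eta>] by (simp add: c'_def field_simps)
    qed
    also have "\<dots> = (\<zeta> - h) * poly q \<zeta> + (\<zeta> - h) * (\<Sum>\<eta>\<in>H. c \<eta> / (\<eta> - h)) * poly p h"
      by (simp add: q sum.distrib sum_distrib_left sum_distrib_right)
    finally have sum_H: "(\<Sum>\<eta>\<in>H. c' \<eta> * poly p \<eta>) = \<dots>" .
    have c'_h: "c' h = 1 - (\<zeta> - h) * (\<Sum>\<eta>\<in>H. c \<eta> / (\<eta> - h))" by (simp add: c'_def)
    show ?thesis
      unfolding sum.insert[OF insert.hyps] sum_H c'_h using split[of \<zeta>] by (simp add: algebra_simps)
  qed
  then show ?case by blast
qed simp

text \<open>Interpolation at \<open>d + 1\<close> equally spaced nodes of the unit interval;
  \<open>C\<close> is the sum of the moduli of the weights and depends on \<open>d\<close> only. In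
  the application \<open>\<i>\<close> is the position of a pole after rescaling by its
  height.\<close>

lemma poly_at_ii_bound:
  obtains C where "C \<ge> 0"
    "\<And>p B. degree p \<le> d \<Longrightarrow> (\<And>\<eta>. \<eta> \<in> {0..1} \<Longrightarrow> cmod (poly p (of_real \<eta>)) \<le> B) \<Longrightarrow> cmod (poly p \<i>) \<le> C * B"
proof -
  define H where "H = (\<lambda>l. complex_of_real (real l / real (Suc d))) ` {..d}"
  have H: "finite H" "card H = Suc d"
    unfolding H_def by (auto simp: card_image inj_on_def simp del: of_nat_Suc)
  obtain c where c: "\<And>p. degree p < card H \<Longrightarrow> poly p \<i> = (\<Sum>\<eta>\<in>H. c \<eta> * poly p \<eta>)"
    using lagrange_weights[OF H(1)] by blast
  show ?thesis
  proof (rule that)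
    show "0 \<le> (\<Sum>\<eta>\<in>H. cmod (c \<eta>))" by (simp add: sum_nonneg)
    fix p :: "complex poly" and B
    assume p: "degree p \<le> d" and B: "\<And>\<eta>. \<eta> \<in> {0..1} \<Longrightarrow> cmod (poly p (of_real \<eta>)) \<le> B"
    have "cmod (poly p \<eta>) \<le> B" if \<eta>: "\<eta> \<in> H" for \<eta>
    proof -
      obtain l where l: "l \<le> d" "\<eta> = of_real (real l / real (Suc d))"
        using \<eta> unfolding H_def by blast
      show ?thesis unfolding l(2) using l(1) by (intro B) (auto simp: divide_simps)
    qed
    then have "cmod (\<Sum>\<eta>\<in>H. c \<eta> * poly p \<eta>) \<le> (\<Sum>\<eta>\<in>H. cmod (c \<eta>) * B)"
      by (intro sum_norm_le) (simp add: norm_mult mult_left_mono)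
    then show "cmod (poly p \<i>) \<le> (\<Sum>\<eta>\<in>H. cmod (c \<eta>)) * B"
      using c[of p] p H by (simp add: sum_distrib_right)
  qed
qed

lemma cmod_diff_le_diff_cnj:
  assumes "Im z \<ge> 0" "Im w \<ge> 0"
  shows "cmod (z - w) \<le> cmod (z - cnj w)"
proof (rule power2_le_imp_le)
  have "(Im z - Im w)\<^sup>2 \<le> (Im z + Im w)\<^sup>2"
    using mult_nonneg_nonneg[OF assms] by (simp add: power2_eq_square algebra_simps)
  then show "(cmod (z - w))\<^sup>2 \<le> (cmod (z - cnj w))\<^sup>2"
    by (simp add: cmod_power2)
qed simp

text \<open>Cleared of denominators, the function is a polynomial which is \<open>O((Im (x j))\<^sup>2)\<close> at real points
  within distance \<open>Im (x j)\<close> of \<open>Re (x j)\<close>, hence by interpolation at \<open>x j\<close> itself, where its value is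
  \<open>r j\<close> times a factor of size \<open>Im (x j)\<close>.\<close>

lemma residue_le_height:
  assumes "finite I" "j \<in> I" and "\<delta> > 0" "R \<ge> 0" "M \<ge> 0"
  obtains C where "\<And>(r :: 'a \<Rightarrow> complex) x. (\<And>k. k \<in> I \<Longrightarrow> Im (x k) > 0 \<and> cmod (x k) \<le> R) \<Longrightarrow>
    (\<And>k. k \<in> I - {j} \<Longrightarrow> \<delta> \<le> cmod (x j - x k)) \<Longrightarrow>
    (\<And>y :: real. cmod (\<i> * (\<Sum>k\<in>I. r k / (of_real y - x k)) - \<i> * (\<Sum>k\<in>I. cnj (r k) / (of_real y - cnj (x k)))) \<le> M) \<Longrightarrow>
    cmod (r j) \<le> C * Im (x j)"
proof -
  define n where "n = card (I - {j})"
  obtain C where C: "C \<ge> 0"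
    "\<And>p B. degree p \<le> 2 * card I \<Longrightarrow> (\<And>\<eta>. \<eta> \<in> {0..1} \<Longrightarrow> cmod (poly p (of_real \<eta>)) \<le> B) \<Longrightarrow> cmod (poly p \<i>) \<le> C * B"
    using poly_at_ii_bound[of "2 * card I"] by metis
  show ?thesis
  proof (rule that)
    fix r x :: "'a \<Rightarrow> complex"
    assume x: "\<And>k. k \<in> I \<Longrightarrow> Im (x k) > 0 \<and> cmod (x k) \<le> R"
      and sep: "\<And>k. k \<in> I - {j} \<Longrightarrow> \<delta> \<le> cmod (x j - x k)"
      and M: "\<And>y. cmod (\<i> * (\<Sum>k\<in>I. r k / (of_real y - x k)) - \<i> * (\<Sum>k\<in>I. cnj (r k) / (of_real y - cnj (x k)))) \<le> M"
    define a \<epsilon> where "a = Re (x j)" and "\<epsilon> = Im (x j)"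
    have \<epsilon>: "\<epsilon> > 0" "\<epsilon> \<le> R" "\<bar>a\<bar> \<le> R" "x j = of_real a + \<i> * of_real \<epsilon>"
      using x[OF \<open>j \<in> I\<close>] abs_Im_le_cmod[of "x j"] abs_Re_le_cmod[of "x j"]
      by (auto simp: a_def \<epsilon>_def complex_eq_iff)
    \<comment> \<open>These are the linear factors at the point
      \<open>a + \<epsilon> * \<eta>\<close>, as polynomials in \<open>\<eta>\<close>. Real
      \<open>\<eta>\<close> gives real points, and \<open>\<eta> = \<i>\<close> gives
      \<open>x j\<close>.\<close>
    define l l' where "l k = [:of_real a - x k, of_real \<epsilon>:]" and "l' k = [:of_real a - cnj (x k), of_real \<epsilon>:]" for k
    define p where "p = (\<Sum>k\<in>I. Polynomial.smult (\<i> * r k) ((\<Prod>i\<in>I - {k}. l i) * (\<Prod>i\<in>I. l' i)))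
      - (\<Sum>k\<in>I. Polynomial.smult (\<i> * cnj (r k)) ((\<Prod>i\<in>I. l i) * (\<Prod>i\<in>I - {k}. l' i)))"
    have deg: "degree (\<Prod>i\<in>J. l i) \<le> card I" "degree (\<Prod>i\<in>J. l' i) \<le> card I" if "J \<subseteq> I" for J
    proof -
      have "card J \<le> card I" using that \<open>finite I\<close> by (rule card_mono[rotated])
      then have "degree (\<Prod>i\<in>J. f i) \<le> card I" if "\<And>i. degree (f i) \<le> 1" for f :: "'a \<Rightarrow> complex poly"
        using degree_prod_sum_le[of J f] sum_bounded_above[of J "\<lambda>i. degree (f i)" 1] that
          finite_subset[OF \<open>J \<subseteq> I\<close> \<open>finite I\<close>] by (auto simp: o_def)
      then show "degree (\<Prod>i\<in>J. l i) \<le> card I" "degree (\<Prod>i\<in>J. l' i) \<le> card I"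
        by (simp_all add: l_def l'_def)
    qed
    have "degree p \<le> 2 * card I"
      unfolding p_def
      by (intro degree_diff_le degree_sum_le \<open>finite I\<close> order_trans[OF degree_smult_le] order_trans[OF degree_mult_le])
        (use deg in \<open>auto simp: mult_2 intro!: add_mono\<close>)
    moreover have "cmod (poly p (of_real \<eta>)) \<le> M * ((2 * \<epsilon>)\<^sup>2 * (3 * R) ^ (2 * n))" if \<eta>: "\<eta> \<in> {0..1}" for \<eta>
    proof -
      define y where "y = a + \<epsilon> * \<eta>"
      have l_y: "poly (l k) (of_real \<eta>) = of_real y - x k" "poly (l' k) (of_real \<eta>) = of_real y - cnj (x k)" for k
        by (simp_all add: l_def l'_def y_def)
      have nz: "of_real y - x k \<noteq> 0" "of_real y - cnj (x k) \<noteq> 0" if "k \<in> I" for k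
        using x[OF that] by (auto simp: complex_eq_iff)
      define A A' where "A = (\<Prod>i\<in>I. of_real y - x i)" and "A' = (\<Prod>i\<in>I. of_real y - cnj (x i))"
      have A_remove: "(\<Prod>i\<in>I - {k}. of_real y - x i) = A / (of_real y - x k)"
        "(\<Prod>i\<in>I - {k}. of_real y - cnj (x i)) = A' / (of_real y - cnj (x k))" if "k \<in> I" for k
        unfolding A_def A'_def prod.remove[OF \<open>finite I\<close> that] using nz[OF that] by simp_all
      have "poly p (of_real \<eta>) = (\<Sum>k\<in>I. \<i> * r k * ((A / (of_real y - x k)) * A'))
          - (\<Sum>k\<in>I. \<i> * cnj (r k) * (A * (A' / (of_real y - cnj (x k)))))"
        by (simp add: p_def poly_sum poly_prod l_y A_remove A_def[symmetric] A'_def[symmetric])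
      also have "\<dots> = (\<i> * (\<Sum>k\<in>I. r k / (of_real y - x k)) - \<i> * (\<Sum>k\<in>I. cnj (r k) / (of_real y - cnj (x k)))) * (A * A')"
        unfolding left_diff_distrib sum_distrib_left sum_distrib_right
        by (intro arg_cong2[where f = "(-)"] sum.cong) (auto simp: divide_inverse mult_ac)
      finally have "cmod (poly p (of_real \<eta>)) \<le> M * cmod (A * A')"
        using mult_right_mono[OF M[of y], of "cmod (A * A')"] by (simp only: norm_mult[of _ "A * A'"] norm_ge_zero)
      \<comment> \<open>At a real point conjugate factors have equal modulus, so the small factor of
        index \<open>j\<close> occurs squared. Below, \<open>2 * \<epsilon>\<close> comes from
        \<open>cmod (of_real \<eta> - \<i>) \<le> 2\<close>, and \<open>3 * R\<close> from
        \<open>\<bar>y\<bar> \<le> 2 * R\<close>.\<close>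
      also have "cmod (A * A') = (cmod (of_real y - x j))\<^sup>2 * (\<Prod>k\<in>I - {j}. (cmod (of_real y - x k))\<^sup>2)"
      proof -
        have "cmod (of_real y - cnj (x k)) = cmod (of_real y - x k)" for k
          using complex_mod_cnj[of "of_real y - x k"] by simp
        then show ?thesis
          by (simp add: A_def A'_def prod.remove[OF \<open>finite I\<close> \<open>j \<in> I\<close>] norm_mult prod_norm[symmetric]
              power2_eq_square prod.distrib)
      qed
      also have "\<dots> \<le> (2 * \<epsilon>)\<^sup>2 * (\<Prod>k\<in>I - {j}. (3 * R)\<^sup>2)"
      proof (intro mult_mono power_mono prod_mono conjI norm_ge_zero)
        have "of_real y - x j = of_real \<epsilon> * (of_real \<eta> - \<i>)"
          by (simp add: \<epsilon>(4) y_def algebra_simps)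
        moreover have "cmod (of_real \<eta> - \<i>) \<le> 2"
          using norm_triangle_ineq4[of "of_real \<eta>" \<i>] \<eta> by simp
        ultimately show "cmod (of_real y - x j) \<le> 2 * \<epsilon>"
          using \<epsilon>(1) by (simp add: norm_mult)
        show "cmod (of_real y - x k) \<le> 3 * R" if "k \<in> I - {j}" for k
        proof -
          have "\<epsilon> * \<eta> \<le> \<epsilon> * 1" "0 \<le> \<epsilon> * \<eta>"
            using \<eta> \<epsilon>(1) by (auto intro: mult_left_mono)
          then have "\<bar>y\<bar> \<le> \<bar>a\<bar> + \<epsilon>"
            unfolding y_def by linarith
          then show ?thesis
            using norm_triangle_ineq4[of "of_real y" "x k"] x[of k] that \<epsilon> by simp
        qed
      qed (auto intro: prod_nonneg)
      also have "(\<Prod>k\<in>I - {j}. (3 * R)\<^sup>2) = (3 * R) ^ (2 * n)"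
        by (simp add: n_def power_mult)
      finally show ?thesis using \<open>M \<ge> 0\<close> by (simp add: mult_left_mono)
    qed
    ultimately have "cmod (poly p \<i>) \<le> C * (M * ((2 * \<epsilon>)\<^sup>2 * (3 * R) ^ (2 * n)))"
      by (rule C(2))
    \<comment> \<open>At \<open>x j\<close> every term containing the factor
      \<open>x j - x j\<close> vanishes, and a single one survives. Its factor
      \<open>x j - cnj (x j)\<close> has modulus \<open>2 * \<epsilon>\<close>; the other
      \<open>2 * n\<close> factors are at least \<open>\<delta>\<close>. Compared with the upper
      bound, one power of \<open>\<epsilon>\<close> is left over.\<close>
    moreover have "\<delta> ^ (2 * n) * (2 * \<epsilon>) * cmod (r j) \<le> cmod (poly p \<i>)"
    proof -
      have l_i: "poly (l k) \<i> = x j - x k" "poly (l' k) \<i> = x j - cnj (x k)" for k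
        by (simp_all add: l_def l'_def \<epsilon>(4) mult.commute)
      have zero: "(\<Prod>i\<in>I. x j - x i) = 0"
        using \<open>finite I\<close> \<open>j \<in> I\<close> by (intro prod_zero bexI[of _ j]) auto
      have zero': "(\<Prod>i\<in>I - {k}. x j - x i) = 0" if "k \<in> I - {j}" for k
        using \<open>finite I\<close> \<open>j \<in> I\<close> that by (intro prod_zero bexI[of _ j]) auto
      have "poly p \<i> = (\<Sum>k\<in>I. \<i> * r k * ((\<Prod>i\<in>I - {k}. x j - x i) * (\<Prod>i\<in>I. x j - cnj (x i))))"
        by (simp add: p_def poly_sum poly_prod l_i zero)
      also have "\<dots> = \<i> * r j * ((\<Prod>i\<in>I - {j}. x j - x i) * (\<Prod>i\<in>I. x j - cnj (x i)))"
        unfolding sum.remove[OF \<open>finite I\<close> \<open>j \<in> I\<close>] using zero' by simp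
      finally have poly_i: "cmod (poly p \<i>) = cmod (r j) * ((\<Prod>i\<in>I - {j}. cmod (x j - x i)) * (cmod (x j - cnj (x j)) * (\<Prod>i\<in>I - {j}. cmod (x j - cnj (x i)))))"
        by (simp add: norm_mult prod.remove[OF \<open>finite I\<close> \<open>j \<in> I\<close>] prod_norm[symmetric])
      have "x j - cnj (x j) = \<i> * of_real (2 * \<epsilon>)"
        by (simp add: \<epsilon>(4))
      then have height: "cmod (x j - cnj (x j)) = 2 * \<epsilon>"
        using \<epsilon>(1) by (simp add: norm_mult)
      have "cmod (r j) * ((\<Prod>i\<in>I - {j}. \<delta>) * (2 * \<epsilon> * (\<Prod>i\<in>I - {j}. \<delta>))) \<le> cmod (poly p \<i>)"
        unfolding poly_i height
      proof (intro mult_left_mono mult_mono prod_mono conjI)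
        fix k assume k: "k \<in> I - {j}"
        show "\<delta> \<le> cmod (x j - x k)" by (rule sep[OF k])
        then show "\<delta> \<le> cmod (x j - cnj (x k))"
          using cmod_diff_le_diff_cnj[of "x j" "x k"] x[of j] x[of k] k \<open>j \<in> I\<close> by auto
      qed (use \<open>\<delta> > 0\<close> \<epsilon> in \<open>auto intro!: prod_nonneg mult_nonneg_nonneg\<close>)
      then show ?thesis
        unfolding prod_constant n_def[symmetric] mult_2[of n] power_add by (simp only: mult_ac)
    qed
    ultimately have "\<delta> ^ (2 * n) * (2 * \<epsilon>) * cmod (r j) \<le> C * (M * ((2 * \<epsilon>)\<^sup>2 * (3 * R) ^ (2 * n)))"
      by linarith
    then have "(2 * \<epsilon>) * (\<delta> ^ (2 * n) * cmod (r j)) \<le> (2 * \<epsilon>) * (C * M * (2 * (3 * R) ^ (2 * n)) * \<epsilon>)"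
      by (simp add: power2_eq_square mult_ac)
    then have "\<delta> ^ (2 * n) * cmod (r j) \<le> C * M * (2 * (3 * R) ^ (2 * n)) * \<epsilon>"
      by (rule mult_left_le_imp_le) (use \<epsilon>(1) in simp)
    then show "cmod (r j) \<le> C * M * (2 * (3 * R) ^ (2 * n)) / \<delta> ^ (2 * n) * Im (x j)"
      using \<open>\<delta> > 0\<close> by (simp add: \<epsilon>_def pos_le_divide_eq mult.commute)
  qed
qed

lemma norm_complex3_le:
  fixes v :: "complex ^ 3"
  shows "norm v \<le> cmod (v$1) + cmod (v$2) + cmod (v$3)"
  using L2_set_le_sum[of UNIV "\<lambda>i. cmod (v $ i)"] by (simp add: norm_vec_def sum_3)

lemma rational_map_component:
  "rational_map N m\<^sub>0 s x y $ i = of_real (m\<^sub>0 $ i)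
    + (\<i> * (\<Sum>k=1..N. s k $ i / (of_real y - x k)) - \<i> * (\<Sum>k=1..N. cnj (s k $ i) / (of_real y - cnj (x k))))"
  by (simp add: rational_map_def cvec_def cnjv_def)

text \<open>The residue estimate is applied to each component, with the bound
  \<open>1 + norm m\<^sub>0\<close> for the rational part. \<open>C\<close> is chosen before the
  spins and poles, so that one constant serves all times at which \<open>\<delta>\<close> and
  \<open>R\<close> are valid.\<close>

lemma spin_le_height:
  assumes j: "j \<in> {1..N}" and "\<delta> > 0" "R \<ge> 0"
  obtains C where "\<And>s x u. (\<And>y. cvec (u y) = rational_map N m\<^sub>0 s x y) \<Longrightarrow> range u \<subseteq> sphere 0 1 \<Longrightarrow>
    (\<And>k. k \<in> {1..N} \<Longrightarrow> Im (x k) > 0 \<and> cmod (x k) \<le> R) \<Longrightarrow>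
    (\<And>k. k \<in> {1..N} - {j} \<Longrightarrow> \<delta> \<le> cmod (x j - x k)) \<Longrightarrow> norm (s j) \<le> C * Im (x j)"
proof -
  have "finite {1..N}" "1 + norm m\<^sub>0 \<ge> 0" by simp_all
  note bound = residue_le_height[OF this(1) j \<open>\<delta> > 0\<close> \<open>R \<ge> 0\<close> this(2)]
  obtain C where
    C: "\<And>(r :: nat \<Rightarrow> complex) x. (\<And>k. k \<in> {1..N} \<Longrightarrow> Im (x k) > 0 \<and> cmod (x k) \<le> R) \<Longrightarrow>
    (\<And>k. k \<in> {1..N} - {j} \<Longrightarrow> \<delta> \<le> cmod (x j - x k)) \<Longrightarrow>
    (\<And>y :: real. cmod (\<i> * (\<Sum>k=1..N. r k / (of_real y - x k)) - \<i> * (\<Sum>k=1..N. cnj (r k) / (of_real y - cnj (x k)))) \<le> 1 + norm m\<^sub>0) \<Longrightarrow>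
    cmod (r j) \<le> C * Im (x j)"
    by (rule bound) blast
  show ?thesis
  proof (rule that)
    fix s :: "nat \<Rightarrow> complex ^ 3" and x :: "nat \<Rightarrow> complex" and u :: "real \<Rightarrow> real ^ 3"
    assume u: "\<And>y. cvec (u y) = rational_map N m\<^sub>0 s x y" "range u \<subseteq> sphere 0 1"
      and x: "\<And>k. k \<in> {1..N} \<Longrightarrow> Im (x k) > 0 \<and> cmod (x k) \<le> R"
        "\<And>k. k \<in> {1..N} - {j} \<Longrightarrow> \<delta> \<le> cmod (x j - x k)"
    have "cmod (s j $ i) \<le> C * Im (x j)" for i
    proof (rule C[where r = "\<lambda>k. s k $ i" and x = x, OF x])
      fix y :: real
      have "(\<i> * (\<Sum>k=1..N. s k $ i / (of_real y - x k)) - \<i> * (\<Sum>k=1..N. cnj (s k $ i) / (of_real y - cnj (x k))))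
        = of_real ((u y - m\<^sub>0) $ i)"
        using arg_cong[OF u(1)[of y], of "\<lambda>v. v $ i"] unfolding rational_map_component
        by (simp add: cvec_def)
      moreover have "\<bar>(u y - m\<^sub>0) $ i\<bar> \<le> norm (u y - m\<^sub>0)"
        by (rule component_le_norm_cart)
      moreover have "norm (u y) = 1" using u(2) by (auto simp: image_subset_iff)
      ultimately show "cmod (\<i> * (\<Sum>k=1..N. s k $ i / (of_real y - x k)) - \<i> * (\<Sum>k=1..N. cnj (s k $ i) / (of_real y - cnj (x k)))) \<le> 1 + norm m\<^sub>0"
        using norm_triangle_ineq4[of "u y" m\<^sub>0] by (simp only: norm_of_real)
    qed
    from this[of 1] this[of 2] this[of 3] show "norm (s j) \<le> 3 * C * Im (x j)"
      using norm_complex3_le[of "s j"] by simp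
  qed
qed

section \<open>Growth of the spins\<close>

text \<open>The hypothesis makes \<open>exp (2 * K * t) * (v t \<bullet> v t)\<close> nondecreasing.
  The square is used because the norm need not be differentiable where \<open>v\<close>
  vanishes.\<close>

lemma norm_le_exp_linear_growth_forward:
  fixes v :: "real \<Rightarrow> 'a::real_inner"
  assumes "a \<le> b"
    and v: "\<And>t. a \<le> t \<Longrightarrow> t \<le> b \<Longrightarrow> (v has_vector_derivative v' t) (at t)"
    and le: "\<And>t. a \<le> t \<Longrightarrow> t \<le> b \<Longrightarrow> norm (v' t) \<le> K * norm (v t)"
  shows "norm (v a) \<le> exp (K * (b - a)) * norm (v b)"
proof -
  define g where "g t = exp (2 * K * t) * (v t \<bullet> v t)" for t
  have mono: "\<exists>y. DERIV g t :> y \<and> 0 \<le> y" if t: "a \<le> t" "t \<le> b" for t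
  proof (intro exI conjI)
    have "((\<lambda>t. v t \<bullet> v t) has_real_derivative 2 * (v t \<bullet> v' t)) (at t)"
      unfolding has_real_derivative_iff_has_vector_derivative
      using bounded_bilinear.has_vector_derivative[OF bounded_bilinear_inner v[OF t] v[OF t]]
      by (simp add: inner_commute)
    then show "DERIV g t :> exp (2 * K * t) * (2 * K * (v t \<bullet> v t) + 2 * (v t \<bullet> v' t))"
      unfolding g_def by (auto intro!: derivative_eq_intros simp: algebra_simps)
    have "- (v t \<bullet> v' t) \<le> norm (v t) * norm (v' t)"
      using Cauchy_Schwarz_ineq2[of "v t" "v' t"] by linarith
    also have "\<dots> \<le> norm (v t) * (K * norm (v t))"
      by (intro mult_left_mono le t) auto
    finally show "0 \<le> exp (2 * K * t) * (2 * K * (v t \<bullet> v t) + 2 * (v t \<bullet> v' t))"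
      by (simp add: dot_square_norm power2_eq_square mult_ac)
  qed
  have "g a \<le> g b"
    by (rule DERIV_nonneg_imp_nondecreasing[OF \<open>a \<le> b\<close> mono])
  then have "(exp (K * a) * norm (v a))\<^sup>2 \<le> (exp (K * b) * norm (v b))\<^sup>2"
    using exp_double[of "K * a"] exp_double[of "K * b"]
    by (simp add: g_def dot_square_norm power_mult_distrib mult.assoc)
  then have "exp (K * a) * norm (v a) \<le> exp (K * b) * norm (v b)"
    by (rule power2_le_imp_le) simp
  then show ?thesis
    by (simp add: right_diff_distrib exp_diff pos_le_divide_eq mult.commute)
qed

text \<open>Time reversal reduces the case \<open>b < a\<close> to the previous lemma. Both
  directions occur: times of \<open>T\<close> lie on either side of 0, and \<open>t\<^sub>0\<close>
  may be either end of \<open>T\<close>.\<close>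

lemma norm_le_exp_linear_growth:
  fixes v :: "real \<Rightarrow> 'a::real_inner"
  assumes v: "\<And>t. t \<in> closed_segment a b \<Longrightarrow> (v has_vector_derivative v' t) (at t)"
    and le: "\<And>t. t \<in> closed_segment a b \<Longrightarrow> norm (v' t) \<le> K * norm (v t)"
  shows "norm (v a) \<le> exp (K * \<bar>b - a\<bar>) * norm (v b)"
proof (cases "a \<le> b")
  case True
  then show ?thesis
    using norm_le_exp_linear_growth_forward[of a b v v' K] v le
    by (auto simp: closed_segment_eq_real_ivl)
next
  case False
  have "((\<lambda>t. v (- t)) has_vector_derivative - v' (- t)) (at t)" if "-a \<le> t" "t \<le> -b" for t
  proof -
    have "(uminus has_vector_derivative - 1) (at t)" by (auto intro!: derivative_eq_intros)
    moreover have "- t \<in> closed_segment a b"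
      using that by (auto simp: closed_segment_eq_real_ivl)
    ultimately show ?thesis
      using vector_diff_chain_at[of uminus "-1" t v "v' (-t)"] v[of "-t"] by (simp add: o_def)
  qed
  moreover have "norm (- v' (- t)) \<le> K * norm (v (- t))" if "-a \<le> t" "t \<le> -b" for t
    using le[of "-t"] that by (auto simp: closed_segment_eq_real_ivl)
  ultimately show ?thesis
    using norm_le_exp_linear_growth_forward[of "-a" "-b" "\<lambda>t. v (- t)" "\<lambda>t. - v' (- t)" K] False
    by (auto simp: minus_diff_commute)
qed

lemma norm_vector_scalar_mult:
  fixes v :: "complex ^ 'n"
  shows "norm (a *s v) = cmod a * norm v"
  by (simp add: norm_vec_def vector_scalar_mult_def norm_mult L2_set_right_distrib)

lemma norm_ccross_le: "norm (ccross u v) \<le> 6 * (norm u * norm v)"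
proof -
  have "cmod (u$i * v$k - u$k * v$i) \<le> 2 * (norm u * norm v)" for i k
  proof -
    have "cmod (u$i * v$k - u$k * v$i) \<le> cmod (u$i) * cmod (v$k) + cmod (u$k) * cmod (v$i)"
      using norm_triangle_ineq4[of "u$i * v$k" "u$k * v$i"] by (simp add: norm_mult)
    also have "\<dots> \<le> norm u * norm v + norm u * norm v"
      by (intro add_mono mult_mono Finite_Cartesian_Product.norm_nth_le) auto
    finally show ?thesis by simp
  qed
  from this[of 2 3] this[of 3 1] this[of 1 2] show ?thesis
    using norm_complex3_le[of "ccross u v"] by (simp add: ccross_def)
qed

text \<open>The equation is linear in \<open>s j\<close>, the other spins acting as coefficients.
  The constant 12 is the factor 2 of the equation times the 6 of
  \<open>norm_ccross_le\<close>.\<close>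

lemma spin_speed_bound:
  "norm (of_real (- 2 * \<sigma>) *s (\<Sum>k\<in>J. (1 / (x j - x k)\<^sup>2) *s ccross (s j) (s k)))
    \<le> 12 * \<bar>\<sigma>\<bar> * (\<Sum>k\<in>J. norm (s k) / (cmod (x j - x k))\<^sup>2) * norm (s j)"
proof -
  have "norm (\<Sum>k\<in>J. (1 / (x j - x k)\<^sup>2) *s ccross (s j) (s k))
    \<le> (\<Sum>k\<in>J. 6 * (norm (s k) / (cmod (x j - x k))\<^sup>2) * norm (s j))"
  proof (rule sum_norm_le)
    fix k
    have "1 / (cmod (x j - x k))\<^sup>2 * norm (ccross (s j) (s k)) \<le> 1 / (cmod (x j - x k))\<^sup>2 * (6 * (norm (s j) * norm (s k)))"
      by (intro mult_left_mono norm_ccross_le) simp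
    then show "norm ((1 / (x j - x k)\<^sup>2) *s ccross (s j) (s k)) \<le> 6 * (norm (s k) / (cmod (x j - x k))\<^sup>2) * norm (s j)"
      by (simp add: norm_vector_scalar_mult norm_divide norm_power mult_ac)
  qed
  then have "2 * \<bar>\<sigma>\<bar> * norm (\<Sum>k\<in>J. (1 / (x j - x k)\<^sup>2) *s ccross (s j) (s k))
    \<le> 2 * \<bar>\<sigma>\<bar> * (\<Sum>k\<in>J. 6 * (norm (s k) / (cmod (x j - x k))\<^sup>2) * norm (s j))"
    by (rule mult_left_mono) simp
  also have "\<dots> = 12 * \<bar>\<sigma>\<bar> * (\<Sum>k\<in>J. norm (s k) / (cmod (x j - x k))\<^sup>2) * norm (s j)"
    by (simp only: sum_distrib_left[symmetric] sum_distrib_right[symmetric])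
  finally show ?thesis by (simp add: norm_vector_scalar_mult norm_mult)
qed

section \<open>No pole reaches the real axis in finite time\<close>

theorem theorem3p1:
  fixes N :: nat
    and T :: "real set"
    and m :: "real \<Rightarrow> real \<Rightarrow> real ^ 3"
    and m\<^sub>0 :: "real ^ 3"
    and s\<^sub>0 :: "nat \<Rightarrow> complex ^ 3"
    and x\<^sub>0 :: "nat \<Rightarrow> complex"
    and s :: "nat \<Rightarrow> real \<Rightarrow> complex ^ 3"
    and x :: "nat \<Rightarrow> real \<Rightarrow> complex"
    and \<sigma> :: real
  assumes time: "open T" "is_interval T" "0 \<in> T"
    and solution: "half_wave_map T m"
    and initial: "\<And>y. cvec (m y 0) = rational_map N m\<^sub>0 s\<^sub>0 x\<^sub>0 y"
    and initial_spins: "\<And>j. j \<in> {1..N} \<Longrightarrow> s\<^sub>0 j \<noteq> 0"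
    and start: "\<And>j. j \<in> {1..N} \<Longrightarrow> s j 0 = s\<^sub>0 j \<and> x j 0 = x\<^sub>0 j"
    and form: "\<And>t y. t \<in> T \<Longrightarrow> cvec (m y t) = rational_map N m\<^sub>0 (\<lambda>j. s j t) (\<lambda>j. x j t) y"
    and upper: "\<And>t j. t \<in> T \<Longrightarrow> j \<in> {1..N} \<Longrightarrow> Im (x j t) > 0"
    and constraints: "\<And>t. t \<in> T \<Longrightarrow> spin_constraints N m\<^sub>0 (\<lambda>j. s j t) (\<lambda>j. x j t)"
    and orientation: "\<sigma> \<in> {1, -1}"
    and dynamics: "spin_pole_dynamics \<sigma> N T m\<^sub>0 s x"
    and no_collision:
      "\<not> (\<exists>i\<in>{1..N}. \<exists>j\<in>{1..N}. i \<noteq> j \<and>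
            (\<exists>t\<^sub>0\<in>closure T. ((\<lambda>t. x i t - x j t) \<longlongrightarrow> 0) (at t\<^sub>0 within T)))"
  shows "\<not> (\<exists>i\<in>{1..N}. \<exists>t\<^sub>0::real. \<exists>\<tau>::nat \<Rightarrow> real.
            range \<tau> \<subseteq> T \<and> \<tau> \<longlonglongrightarrow> t\<^sub>0 \<and> (\<lambda>n. Im (x i (\<tau> n))) \<longlonglongrightarrow> 0)"
proof
  assume "\<exists>i\<in>{1..N}. \<exists>t\<^sub>0::real. \<exists>\<tau>::nat \<Rightarrow> real.
    range \<tau> \<subseteq> T \<and> \<tau> \<longlonglongrightarrow> t\<^sub>0 \<and> (\<lambda>n. Im (x i (\<tau> n))) \<longlonglongrightarrow> 0"
  then obtain i t\<^sub>0 \<tau> where i: "i \<in> {1..N}" and \<tau>: "\<And>n. \<tau> n \<in> T" "\<tau> \<longlonglongrightarrow> t\<^sub>0" "(\<lambda>n. Im (x i (\<tau> n))) \<longlonglongrightarrow> 0"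
    by blast
  define I where "I = {1..N}"
  have [simp]: "finite I" by (simp add: I_def)
  define v where "v j t = of_real (- 2 * \<sigma>) *s (\<Sum>k\<in>I - {j}. (1 / (x j t - x k t)\<^sup>2) *s ccross (s j t) (s k t))" for j t
  obtain w where s: "\<And>j t. j \<in> I \<Longrightarrow> t \<in> T \<Longrightarrow> (s j has_vector_derivative v j t) (at t)"
    and x: "\<And>j t. j \<in> I \<Longrightarrow> t \<in> T \<Longrightarrow> (x j has_vector_derivative w j t) (at t)"
    and w: "\<And>j t. j \<in> I \<Longrightarrow> t \<in> T \<Longrightarrow> (w j has_vector_derivative
      4 * (\<Sum>k\<in>I - {j}. cdot (s j t) (s k t) / (x j t - x k t) ^ 3)) (at t)"
    using dynamics unfolding spin_pole_dynamics_def v_def I_def by blast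
  have \<sigma>: "\<bar>\<sigma>\<bar> = 1" "(\<i> * of_real \<sigma>)\<^sup>2 = (-1 :: complex)"
    using orientation by auto
  have null: "cdot (s j t) (s j t) = 0" if "j \<in> I" "t \<in> T" for j t
    using constraints[OF that(2)] that(1) by (simp add: spin_constraints_def I_def)
  have cont_x: "continuous_on T (x j)" and cont_s: "continuous_on T (s j)" if "j \<in> I" for j
    using x[OF that] s[OF that]
    by (auto intro!: continuous_at_imp_continuous_on has_vector_derivative_continuous)
  have no_coll: "\<not> ((\<lambda>t. x j t - x k t) \<longlongrightarrow> 0) (at t within T)" if "j \<in> I" "k \<in> I" "j \<noteq> k" "t \<in> closure T" for j k t
    using no_collision that unfolding I_def by blast
  \<comment> \<open>At a time of \<open>T\<close> coinciding poles are, by continuity, a collision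
    in the sense of the limit hypothesis.\<close>
  have distinct: "x j t \<noteq> x k t" if "j \<in> I" "k \<in> I" "j \<noteq> k" "t \<in> T" for j k t
  proof
    assume eq: "x j t = x k t"
    have "((\<lambda>t. x j t - x k t) \<longlongrightarrow> x j t - x k t) (at t within T)"
      using cont_x that by (intro tendsto_diff) (auto simp: continuous_on_def)
    moreover have "t \<in> closure T" using that(4) closure_subset by blast
    ultimately show False using eq no_coll[OF that(1-3)] by simp
  qed
  have t\<^sub>0: "t\<^sub>0 \<in> closure T"
    unfolding closure_sequential using \<tau> by blast
  \<comment> \<open>At a time of \<open>T\<close> the limit of the heights would be
    \<open>Im (x i t\<^sub>0)\<close>, which is positive. Hence \<open>t\<^sub>0\<close> is an end
    of \<open>T\<close>.\<close>
  have "t\<^sub>0 \<notin> T"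
  proof
    assume "t\<^sub>0 \<in> T"
    then have "(\<lambda>n. x i (\<tau> n)) \<longlonglongrightarrow> x i t\<^sub>0"
      by (intro continuous_on_tendsto_compose[OF cont_x]) (simp_all add: i[folded I_def] \<tau>(1,2))
    then have "(\<lambda>n. Im (x i (\<tau> n))) \<longlonglongrightarrow> Im (x i t\<^sub>0)" by (rule tendsto_Im)
    with \<tau>(3) have "Im (x i t\<^sub>0) = 0" using LIMSEQ_unique by blast
    with upper[OF \<open>t\<^sub>0 \<in> T\<close> i] show False by simp
  qed

  \<comment> \<open>Poles being distinct on \<open>T\<close>, the coefficient of the linear spin
    equation is continuous and so bounded on the compact segment from 0 to \<open>t\<close>; a spin
    that is nonzero at time 0 cannot reach 0.\<close>
  have nonzero: "s j t \<noteq> 0" if j: "j \<in> I" and t: "t \<in> T" for j t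
  proof -
    define K where "K t = 12 * \<bar>\<sigma>\<bar> * (\<Sum>k\<in>I - {j}. norm (s k t) / (cmod (x j t - x k t))\<^sup>2)" for t
    have sub: "closed_segment 0 t \<subseteq> T"
      using time t by (simp add: closed_segment_subset is_interval_convex_1)
    have "continuous_on T K"
      unfolding K_def using j distinct by (auto intro!: continuous_intros cont_x cont_s)
    then have "compact (K ` closed_segment 0 t)"
      by (intro compact_continuous_image continuous_on_subset[OF _ sub]) auto
    then obtain B where "\<forall>r\<in>closed_segment 0 t. \<bar>K r\<bar> \<le> B"
      by (auto dest!: compact_imp_bounded simp: bounded_iff)
    then have B: "K r \<le> B" if "r \<in> closed_segment 0 t" for r
      using that abs_le_D1 by blast
    have "norm (s j 0) \<le> exp (B * \<bar>t - 0\<bar>) * norm (s j t)"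
    proof (rule norm_le_exp_linear_growth)
      fix r assume r: "r \<in> closed_segment 0 t"
      show "(s j has_vector_derivative v j r) (at r)"
        using s[OF j] r sub by blast
      have "norm (v j r) \<le> K r * norm (s j r)"
        unfolding v_def K_def by (rule spin_speed_bound)
      also have "\<dots> \<le> B * norm (s j r)"
        by (intro mult_right_mono B r) simp
      finally show "norm (v j r) \<le> B * norm (s j r)" .
    qed
    moreover have "s j 0 \<noteq> 0"
      using initial_spins[of j] start[of j] j by (simp add: I_def)
    ultimately show ?thesis by auto
  qed

  have lim: "\<exists>l. (x j \<longlongrightarrow> l) (at t\<^sub>0 within T)" if j: "j \<in> I" for j
  proof -
    \<comment> \<open>The frame is fixed for all times at once, because the matrix of initial data
      must not change with the time at which the pole is evaluated.\<close>
    obtain c where P: "\<And>j t. j \<in> I \<Longrightarrow> t \<in> T \<Longrightarrow> frame_P c (s j t) \<noteq> 0"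
      using generic_frame[of I T s v] s null nonzero by auto
    define p b where "p j t = frame_P c (s j t)" and "b j t = frame_b c (s j t)" for j t
    define L where "L = lax_L (\<i> * of_real \<sigma>) (\<lambda>l. p l 0) (\<lambda>l. b l 0) (\<lambda>l. x l 0) (\<lambda>l. w l 0)"
    have root: "det (mat N N (\<lambda>(i, k). (if i = k then x (Suc i) 0 else 0) + of_real t * L (Suc i) (Suc k)
      - (if i = k then x j t else 0))) = 0" if t: "t \<in> T" for t
      unfolding L_def
    proof (rule pole_is_char_root[OF time(2,3) t \<sigma>(2)])
      show "j \<in> {1..N}" using j by (simp add: I_def)
      fix t assume t: "t \<in> T"
      show "inj_on (\<lambda>l. x l t) {1..N}"
        using distinct[OF _ _ _ t] unfolding inj_on_def I_def by blast
      fix l assume "l \<in> {1..N}"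
      then have l: "l \<in> I" by (simp add: I_def)
      show "(x l has_vector_derivative w l t) (at t)" using x[OF l t] .
      have "4 * (\<Sum>k\<in>I - {l}. cdot (s l t) (s k t) / (x l t - x k t) ^ 3)
        = - 2 * (\<Sum>k\<in>I - {l}. p l t * p k t * (b l t - b k t)\<^sup>2 / (x l t - x k t) ^ 3)"
        unfolding sum_distrib_left
      proof (intro sum.cong refl)
        fix k assume "k \<in> I - {l}"
        then have k: "k \<in> I" by simp
        show "4 * (cdot (s l t) (s k t) / (x l t - x k t) ^ 3)
          = - 2 * (p l t * p k t * (b l t - b k t)\<^sup>2 / (x l t - x k t) ^ 3)"
          unfolding cdot_null_frame[OF null[OF l t] P[OF l t] null[OF k t] P[OF k t]] p_def b_def by simp
      qed
      from w[OF l t, unfolded this] show "(w l has_vector_derivative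
        - 2 * (\<Sum>k\<in>{1..N} - {l}. p l t * p k t * (b l t - b k t)\<^sup>2 / (x l t - x k t) ^ 3)) (at t)"
        unfolding I_def .
      note flow = spin_frame_flow[OF l s[OF l t, unfolded v_def] null[OF _ t] P[OF _ t]]
      show "(p l has_vector_derivative
        - 2 * (\<i> * of_real \<sigma>) * p l t * (\<Sum>k\<in>{1..N} - {l}. p k t * (b l t - b k t) / (x l t - x k t)\<^sup>2)) (at t)"
        using flow(1) unfolding p_def b_def I_def .
      show "(b l has_vector_derivative
        \<i> * of_real \<sigma> * (\<Sum>k\<in>{1..N} - {l}. p k t * (b l t - b k t)\<^sup>2 / (x l t - x k t)\<^sup>2)) (at t)"
        using flow(2) unfolding p_def b_def I_def .
    qed
    show ?thesis
      by (rule root_curve_converges[OF time(2) t\<^sub>0 cont_x[OF j] root])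
  qed
  then obtain l where l: "\<And>j. j \<in> I \<Longrightarrow> (x j \<longlongrightarrow> l j) (at t\<^sub>0 within T)"
    by metis
  \<comment> \<open>Since both poles converge, equal limits would be a collision at
    \<open>t\<^sub>0\<close>.\<close>
  have l_distinct: "l j \<noteq> l k" if "j \<in> I" "k \<in> I" "j \<noteq> k" for j k
    using tendsto_diff[OF l[OF that(1)] l[OF that(2)]] no_coll[OF that t\<^sub>0] by auto

  \<comment> \<open>The element 2 keeps \<open>D\<close> nonempty when there is only one pole.
    Halving the minimum leaves room for the strict inequalities to hold near
    \<open>t\<^sub>0\<close>.\<close>
  define D where "D = insert 2 ((\<lambda>(j, k). cmod (l j - l k)) ` (I \<times> I - Id))"
  define \<delta> where "\<delta> = Min D / 2"
  have D: "finite D" "D \<noteq> {}" unfolding D_def by simp_all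
  have "r > 0" if "r \<in> D" for r
    using that l_distinct unfolding D_def by fastforce
  then have "Min D > 0" using D by simp
  have \<delta>: "\<delta> > 0" "\<And>r. r \<in> D \<Longrightarrow> \<delta> < r"
    using \<open>Min D > 0\<close> Min_le[OF D(1)] unfolding \<delta>_def by fastforce+
  define R where "R = 1 + (\<Sum>j\<in>I. cmod (l j))"
  have "R \<ge> 0" unfolding R_def by (simp add: sum_nonneg add_nonneg_nonneg)
  have "\<forall>\<^sub>F t in at t\<^sub>0 within T. cmod (x j t) < R" if "j \<in> I" for j
  proof (rule order_tendstoD(2)[OF tendsto_norm[OF l[OF that]]])
    show "cmod (l j) < R"
      unfolding R_def using member_le_sum[of j I "\<lambda>j. cmod (l j)"] that by simp
  qed
  moreover have "\<forall>\<^sub>F t in at t\<^sub>0 within T. \<delta> < cmod (x j t - x k t)" if "j \<in> I" "k \<in> I - {j}" for j k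
    using that by (intro order_tendstoD(1)[OF tendsto_norm[OF tendsto_diff[OF l l]]] \<delta>(2)) (auto simp: D_def)
  ultimately have "\<forall>\<^sub>F t in at t\<^sub>0 within T. \<forall>j\<in>I. cmod (x j t) < R \<and> (\<forall>k\<in>I - {j}. \<delta> < cmod (x j t - x k t))"
    by (intro eventually_ball_finite ballI eventually_conj) auto
  then obtain d where d: "d > 0" "\<And>t. t \<in> T \<Longrightarrow> dist t t\<^sub>0 < d \<Longrightarrow>
      \<forall>j\<in>I. cmod (x j t) < R \<and> (\<forall>k\<in>I - {j}. \<delta> < cmod (x j t - x k t))"
    unfolding eventually_at using \<open>t\<^sub>0 \<notin> T\<close> by metis
  define S where "S = T \<inter> ball t\<^sub>0 d"
  have S: "cmod (x j t) < R" "\<And>k. k \<in> I - {j} \<Longrightarrow> \<delta> < cmod (x j t - x k t)" if "t \<in> S" "j \<in> I" for t j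
    using d(2)[of t] that by (auto simp: S_def dist_commute)

  have "\<exists>C. \<forall>t\<in>S. norm (s j t) \<le> C * Im (x j t)" if j: "j \<in> I" for j
  proof -
    obtain C where C: "\<And>s x u. (\<And>y. cvec (u y) = rational_map N m\<^sub>0 s x y) \<Longrightarrow> range u \<subseteq> sphere 0 1 \<Longrightarrow>
      (\<And>k. k \<in> {1..N} \<Longrightarrow> Im (x k) > 0 \<and> cmod (x k) \<le> R) \<Longrightarrow>
      (\<And>k. k \<in> {1..N} - {j} \<Longrightarrow> \<delta> \<le> cmod (x j - x k)) \<Longrightarrow> norm (s j) \<le> C * Im (x j)"
      by (rule spin_le_height[OF j[unfolded I_def] \<delta>(1) \<open>R \<ge> 0\<close>, of m\<^sub>0]) blast
    have "norm (s j t) \<le> C * Im (x j t)" if t: "t \<in> S" for t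
    proof (rule C[where s = "\<lambda>j. s j t" and x = "\<lambda>j. x j t" and u = "\<lambda>y. m y t"])
      have "t \<in> T" using t by (simp add: S_def)
      then show "cvec (m y t) = rational_map N m\<^sub>0 (\<lambda>j. s j t) (\<lambda>j. x j t) y" for y by (rule form)
      show "range (\<lambda>y. m y t) \<subseteq> sphere 0 1"
        using solution \<open>t \<in> T\<close> unfolding half_wave_map_def by blast
      show "Im (x k t) > 0 \<and> cmod (x k t) \<le> R" if "k \<in> {1..N}" for k
        using upper[OF \<open>t \<in> T\<close> that] S(1)[OF t, of k] that by (simp add: I_def)
      show "\<delta> \<le> cmod (x j t - x k t)" if "k \<in> {1..N} - {j}" for k
        using S(2)[OF t j, of k] that by (simp add: I_def)
    qed
    then show ?thesis by blast
  qed
  then obtain C where C: "\<And>j t. j \<in> I \<Longrightarrow> t \<in> S \<Longrightarrow> norm (s j t) \<le> C j * Im (x j t)"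
    by metis

  \<comment> \<open>Near \<open>t\<^sub>0\<close> each spin is at most
    \<open>\<bar>C k\<bar> * R\<close>, as heights are below \<open>R\<close>, and each denominator
    is at least \<open>\<delta>\<^sup>2\<close>. The absolute value is taken because the sign of
    \<open>C k\<close> is unknown.\<close>
  define K where "K = 12 * \<bar>\<sigma>\<bar> * (\<Sum>k\<in>I - {i}. (\<bar>C k\<bar> * R) / \<delta>\<^sup>2)"
  have i': "i \<in> I" using i by (simp add: I_def)
  have speed: "norm (v i t) \<le> K * norm (s i t)" if t: "t \<in> S" for t
  proof -
    have "norm (v i t) \<le> 12 * \<bar>\<sigma>\<bar> * (\<Sum>k\<in>I - {i}. norm (s k t) / (cmod (x i t - x k t))\<^sup>2) * norm (s i t)"
      unfolding v_def by (rule spin_speed_bound)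
    also have "\<dots> \<le> K * norm (s i t)"
      unfolding K_def
    proof (intro mult_right_mono mult_left_mono sum_mono frac_le)
      fix k assume k: "k \<in> I - {i}"
      then have "norm (s k t) \<le> C k * Im (x k t)" using t by (intro C) auto
      also have "\<dots> \<le> \<bar>C k\<bar> * \<bar>Im (x k t)\<bar>"
        unfolding abs_mult[symmetric] by (rule abs_ge_self)
      also have "\<dots> \<le> \<bar>C k\<bar> * R"
        using abs_Im_le_cmod[of "x k t"] S(1)[OF t, of k] k by (intro mult_left_mono) auto
      finally show "norm (s k t) \<le> \<bar>C k\<bar> * R" .
      show "\<delta>\<^sup>2 \<le> (cmod (x i t - x k t))\<^sup>2"
        using S(2)[OF t i' k] \<delta>(1) by (intro power_mono) auto
    qed (use \<delta>(1) \<open>R \<ge> 0\<close> in auto)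
    finally show ?thesis .
  qed
  have "\<forall>\<^sub>F n in sequentially. \<tau> n \<in> S"
    using tendstoD[OF \<tau>(2) d(1)] by eventually_elim (use \<tau>(1) in \<open>auto simp: S_def dist_commute\<close>)
  then obtain n\<^sub>0 where n\<^sub>0: "\<And>n. n \<ge> n\<^sub>0 \<Longrightarrow> \<tau> n \<in> S"
    by (auto simp: eventually_sequentially)
  define t\<^sub>1 where "t\<^sub>1 = \<tau> n\<^sub>0"
  have t\<^sub>1: "t\<^sub>1 \<in> S" unfolding t\<^sub>1_def by (rule n\<^sub>0) simp
  \<comment> \<open>The spin at one fixed time is compared with the spin at \<open>\<tau> n\<close>.
    The exponential stays bounded as the times converge, while the height of the pole tends to 0; so
    the spin at the fixed time would have to vanish.\<close>
  have "norm (s i t\<^sub>1) \<le> exp (K * \<bar>\<tau> n - t\<^sub>1\<bar>) * (C i * Im (x i (\<tau> n)))" if "n \<ge> n\<^sub>0" for n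
  proof -
    have sub: "closed_segment t\<^sub>1 (\<tau> n) \<subseteq> S"
    proof (rule closed_segment_subset[OF t\<^sub>1 n\<^sub>0[OF that]])
      show "convex S"
        unfolding S_def using time(2) by (intro convex_Int convex_ball) (simp add: is_interval_convex_1)
    qed
    have "norm (s i t\<^sub>1) \<le> exp (K * \<bar>\<tau> n - t\<^sub>1\<bar>) * norm (s i (\<tau> n))"
    proof (rule norm_le_exp_linear_growth)
      fix r assume "r \<in> closed_segment t\<^sub>1 (\<tau> n)"
      with sub have r: "r \<in> S" by blast
      show "(s i has_vector_derivative v i r) (at r)"
        using r by (intro s i') (simp add: S_def)
      show "norm (v i r) \<le> K * norm (s i r)" by (rule speed[OF r])
    qed
    also have "\<dots> \<le> exp (K * \<bar>\<tau> n - t\<^sub>1\<bar>) * (C i * Im (x i (\<tau> n)))"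
      by (intro mult_left_mono C[OF i' n\<^sub>0[OF that]]) simp
    finally show ?thesis .
  qed
  moreover have "(\<lambda>n. exp (K * \<bar>\<tau> n - t\<^sub>1\<bar>) * (C i * Im (x i (\<tau> n)))) \<longlonglongrightarrow> exp (K * \<bar>t\<^sub>0 - t\<^sub>1\<bar>) * (C i * 0)"
    by (intro tendsto_intros \<tau>(2,3))
  ultimately have "norm (s i t\<^sub>1) \<le> exp (K * \<bar>t\<^sub>0 - t\<^sub>1\<bar>) * (C i * 0)"
    by (intro LIMSEQ_le_const) auto
  then have "s i t\<^sub>1 = 0" by simp
  moreover have "s i t\<^sub>1 \<noteq> 0"
    using nonzero[OF i'] t\<^sub>1 by (simp add: S_def)
  ultimately show False by contradiction
qed

end
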